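(* Let $\Lambda_T=\{\rho(T) : T \text{ is a cop-win tree}\}$, where $T$ ranges over all (finite or infinite) cop-win trees. Then $$\Lambda_T=\omega\cup\{\alpha+\omega : \alpha \text{ is a nonzero limit ordinal}\}.$$ In other words, the CR-ordinal of a cop-win tree is either a finite ordinal or of the form $\alpha+\omega$ with $\alpha$ a nonzero limit ordinal, and every such ordinal is the CR-ordinal of some cop-win tree.
   Context: All graphs are simple and undirected, possibly infinite. For a vertex $v$ of a graph $G$, $N[v]$ denotes its closed neighbourhood. Define binary relations $\leq_\alpha$ on $V(G)$, for every ordinal $\alpha$, by transfinite recursion: $u\leq_0 v$ iff $u=v$; for $\alpha>0$, $u\leq_\alpha v$ iff for every $x\in N[u]$ there exist $y\in N[v]$ and an ordinal $\beta<\alpha$ with $x\leq_\beta y$. These relations increase with $\alpha$, and the CR-ordinal $\rho(G)$ is the least ordinal $\rho$ with $\leq_\rho=\leq_{\rho+1}$. A graph is cop-win if in the game of Cops and Robbers (a cop and a robber alternately move along edges or stay put, the cop choosing a starting vertex first, then the robber; the cop wins upon occupying the robber's vertex) a single cop has a strategy guaranteeing capture. It is known that a graph $G$ is cop-win iff the relation $\leq_\rho$ (for $\rho=\rho(G)$) is all of $V(G)\times V(G)$, and that a tree is cop-win iff it contains no ray (one-way infinite path). Here $\omega$ is the set of finite ordinals; a limit ordinal is a nonzero ordinal that is not a successor. *)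

theory Defs
  imports Main
begin

section \<open>Graphs\<close>

text \<open>A simple undirected graph is a vertex set V (a subset of the type) together with
  a symmetric irreflexive adjacency relation E whose edges lie inside V.\<close>

definition simple_graph :: "'a set \<Rightarrow> ('a \<Rightarrow> 'a \<Rightarrow> bool) \<Rightarrow> bool" where
  "simple_graph V E \<longleftrightarrow> (\<forall>u v. E u v \<longrightarrow> u \<in> V \<and> v \<in> V \<and> u \<noteq> v \<and> E v u)"

definition cnbhd :: "'a set \<Rightarrow> ('a \<Rightarrow> 'a \<Rightarrow> bool) \<Rightarrow> 'a \<Rightarrow> 'a set" where
  "cnbhd V E v = insert v {u \<in> V. E v u}"

definition connected_graph :: "'a set \<Rightarrow> ('a \<Rightarrow> 'a \<Rightarrow> bool) \<Rightarrow> bool" where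
  "connected_graph V E \<longleftrightarrow> (\<forall>u\<in>V. \<forall>v\<in>V. (u, v) \<in> {(x, y). E x y}\<^sup>*)"

definition has_cycle :: "'a set \<Rightarrow> ('a \<Rightarrow> 'a \<Rightarrow> bool) \<Rightarrow> bool" where
  "has_cycle V E \<longleftrightarrow> (\<exists>xs. 3 \<le> length xs \<and> distinct xs \<and> set xs \<subseteq> V \<and>
      (\<forall>i. Suc i < length xs \<longrightarrow> E (xs ! i) (xs ! Suc i)) \<and> E (last xs) (hd xs))"

definition tree :: "'a set \<Rightarrow> ('a \<Rightarrow> 'a \<Rightarrow> bool) \<Rightarrow> bool" where
  "tree V E \<longleftrightarrow> simple_graph V E \<and> V \<noteq> {} \<and> connected_graph V E \<and> \<not> has_cycle V E"

section \<open>Cops and Robbers\<close>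

text \<open>Positions: c n is the cop's position and r n the robber's position after round n.
  Round 0: the cop chooses c 0, then the robber chooses r 0. In round n+1 the cop moves
  from c n to c (n+1) in N[c n], then the robber moves from r n to r (n+1) in N[r n].
  The robber is caught once c n = r n, or when the cop's move lands on the robber,
  c (n+1) = r n. A cop strategy maps the history of the play so far
  [c 0, r 0, ..., c n, r n] to the next cop position.\<close>

definition history :: "(nat \<Rightarrow> 'a) \<Rightarrow> (nat \<Rightarrow> 'a) \<Rightarrow> nat \<Rightarrow> 'a list" where
  "history c r n = concat (map (\<lambda>i. [c i, r i]) [0..<Suc n])"

definition cop_win :: "'a set \<Rightarrow> ('a \<Rightarrow> 'a \<Rightarrow> bool) \<Rightarrow> bool" where
  "cop_win V E \<longleftrightarrow> (\<exists>\<sigma> :: 'a list \<Rightarrow> 'a. \<sigma> [] \<in> V \<and>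
     (\<forall>c r. c 0 = \<sigma> [] \<and> (\<forall>n. c (Suc n) = \<sigma> (history c r n)) \<and>
            r 0 \<in> V \<and> (\<forall>n. r (Suc n) \<in> cnbhd V E (r n)) \<longrightarrow>
        (\<exists>n. (\<forall>m\<le>n. c (Suc m) \<in> cnbhd V E (c m)) \<and> (c n = r n \<or> c (Suc n) = r n))))"

section \<open>Ordinals as well-orders\<close>

text \<open>Ordinals are represented by well-order relations (up to order isomorphism =o);
  an element i of the field of a well-order r stands for the ordinal of its strict
  initial segment, so j strictly below i in r ranges over exactly the smaller ordinals.\<close>

definition nonzero_limit :: "'b rel \<Rightarrow> bool" where
  "nonzero_limit a \<longleftrightarrow> Field a \<noteq> {} \<and> (\<forall>x\<in>Field a. \<exists>y\<in>Field a. (x, y) \<in> a \<and> x \<noteq> y)"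

text \<open>Ordinal sum alpha + omega.\<close>
definition plus_omega :: "'b rel \<Rightarrow> ('b + nat) rel" where
  "plus_omega a = {(Inl x, Inl y) | x y. (x, y) \<in> a} \<union> {(Inl x, Inr n) | x n. x \<in> Field a}
                  \<union> {(Inr m, Inr n) | m n. m \<le> n}"

text \<open>Ordinal sum s + 2: the position Inr False has order type s, Inr True has order type s+1.\<close>
definition plus_two :: "'b rel \<Rightarrow> ('b + bool) rel" where
  "plus_two s = {(Inl x, Inl y) | x y. (x, y) \<in> s} \<union> {(Inl x, Inr b) | x b. x \<in> Field s}
                  \<union> {(Inr False, Inr False), (Inr False, Inr True), (Inr True, Inr True)}"

section \<open>The relations \<le>_alpha and the CR-ordinal\<close>

text \<open>crle V E r i is the relation \<le>_alpha on V, where alpha is the order type of the strict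
  initial segment of i in the well-order r (defined by transfinite recursion).\<close>
definition crle :: "'a set \<Rightarrow> ('a \<Rightarrow> 'a \<Rightarrow> bool) \<Rightarrow> 'b rel \<Rightarrow> 'b \<Rightarrow> 'a rel" where
  "crle V E r = wfrec (r - Id) (\<lambda>f i.
     if (\<exists>j. (j, i) \<in> r - Id)
     then {(u, v). u \<in> V \<and> v \<in> V \<and>
             (\<forall>x\<in>cnbhd V E u. \<exists>y\<in>cnbhd V E v. \<exists>j. (j, i) \<in> r - Id \<and> (x, y) \<in> f j)}
     else {(u, v). u \<in> V \<and> v \<in> V \<and> u = v})"

text \<open>is_CR_ordinal V E s: the well-order s has order type rho(G), i.e. it is the least
  ordinal rho with \<le>_rho = \<le>_(rho+1).\<close>
definition is_CR_ordinal :: "'a set \<Rightarrow> ('a \<Rightarrow> 'a \<Rightarrow> bool) \<Rightarrow> 'b rel \<Rightarrow> bool" where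
  "is_CR_ordinal V E s \<longleftrightarrow> Well_order s \<and>
     (let r = plus_two s in
        crle V E r (Inr False) = crle V E r (Inr True) \<and>
        (\<forall>j k. (j, Inr False) \<in> r - Id \<and> (j, k) \<in> r - Id \<and> (\<forall>m. (j, m) \<in> r - Id \<longrightarrow> (k, m) \<in> r)
               \<longrightarrow> crle V E r j \<noteq> crle V E r k))"

text \<open>Membership of the ordinal s in omega \<union> {alpha + omega : alpha nonzero limit}.\<close>
definition in_Lambda :: "'b rel \<Rightarrow> bool" where
  "in_Lambda s \<longleftrightarrow> finite (Field s) \<or>
     (\<exists>a :: 'b rel. Well_order a \<and> nonzero_limit a \<and> (s, plus_omega a) \<in> ordIso)"

end

theory Submission
  imports Defs
begin

text \<open>
  In a rayless tree the cop always steps towards the robber. Give an arc (u, v), i.e. a robber at u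
  with the cop on its neighbour v, the well-founded rank of the part of the tree beyond u. Passing
  from one root to another changes ranks by finite amounts only. If all ranks are finite, they are
  bounded, so the CR-ordinal is finite. Otherwise let \<open>\<alpha>\<close> be the limit part common to the rooted
  ranks of the whole tree. Chasing gives \<open>\<rho> \<le> \<alpha> + \<omega>\<close>. Conversely there is a vertex w whose branches have
  ranks cofinal in \<open>\<alpha>\<close>; there are arbitrarily long paths starting at w, and a robber waiting at w for a
  cop at distance n and then escaping into a sufficiently deep branch shows \<open>\<rho> > \<alpha> + m\<close> for all m.
  Finite ordinals are realised by paths, and \<open>\<alpha> + \<omega>\<close> by the tree of finite descending sequences
  in \<open>\<alpha>\<close>.
\<close>

section \<open>Positions in well-orders\<close>

text \<open>Why \<omega> itself is missing: it would need ranks that are all finite but unbounded.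
  Vertices may have infinite degree, so no maximum over neighbours is available. The bound comes
  from reversing an arc: the one rank of (v, w) controls all arcs into v except (w, v). Why the
  value is exactly \<alpha> + \<omega>: the cop's reply to a robber at w costs at least \<alpha>,
  since the branches at w are cofinal in \<alpha> while the cop's own branch, if it is among them,
  has rank below \<alpha>. Branches of large rank also reach arbitrarily far from w, so each finite
  delay occurs. In the other direction every arc has rank below \<alpha> + \<omega>, but with a
  finite excess that depends on the arc. Formally the ambient well-order is
  \<open>plus_two s\<close> with \<open>s\<close> unknown, and it might stop soon after \<alpha>.
  Hence the bounds for \<alpha> + n are stated with iterates of \<open>cop_step\<close> and
  \<open>arc_step\<close> rather than with positions. The general link between cop-win and a total
  final relation is not assumed: for these trees it is proved by induction on arcs.\<close>

definition succ_pos :: "'b rel \<Rightarrow> 'b \<Rightarrow> 'b \<Rightarrow> bool" where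
  "succ_pos r j k \<longleftrightarrow> (j, k) \<in> r - Id \<and> (\<forall>m. (j, m) \<in> r - Id \<longrightarrow> (k, m) \<in> r)"

definition limit_pos :: "'b rel \<Rightarrow> 'b \<Rightarrow> bool" where
  "limit_pos r i \<longleftrightarrow> underS r i \<noteq> {} \<and> (\<forall>j\<in>underS r i. \<exists>k\<in>underS r i. j \<in> underS r k)"

lemma Well_order_wf: "Well_order r \<Longrightarrow> wf (r - Id)"
  by (simp add: well_order_on_def)

lemma Well_order_refl: "Well_order r \<Longrightarrow> i \<in> Field r \<Longrightarrow> (i, i) \<in> r"
  by (simp add: order_on_defs refl_on_def)

lemma Well_order_trans: "Well_order r \<Longrightarrow> (i, j) \<in> r \<Longrightarrow> (j, k) \<in> r \<Longrightarrow> (i, k) \<in> r"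
  unfolding order_on_defs by (meson transD)

lemma Well_order_antisym: "Well_order r \<Longrightarrow> (i, j) \<in> r \<Longrightarrow> (j, i) \<in> r \<Longrightarrow> i = j"
  unfolding order_on_defs by (meson antisymD)

lemma Well_order_total:
  "Well_order r \<Longrightarrow> i \<in> Field r \<Longrightarrow> j \<in> Field r \<Longrightarrow> (i, j) \<in> r \<or> j \<in> underS r i"
  by (cases "i = j") (auto simp: order_on_defs total_on_def refl_on_def underS_def)

lemma underS_trans:
  assumes "Well_order r" "j \<in> underS r i" "(i, k) \<in> r"
  shows "j \<in> underS r k"
  using assms Well_order_trans[OF assms(1)] Well_order_antisym[OF assms(1)]
  unfolding underS_def by blast

lemma underS_trans':
  assumes "Well_order r" "(j, i) \<in> r" "i \<in> underS r k"
  shows "j \<in> underS r k"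
  using assms Well_order_trans[OF assms(1)] Well_order_antisym[OF assms(1)]
  unfolding underS_def by blast

lemma underS_induct [consumes 1, case_names less]:
  assumes "Well_order r" and "\<And>i. (\<And>j. j \<in> underS r i \<Longrightarrow> P j) \<Longrightarrow> P i"
  shows "P i"
  using Well_order_wf[OF assms(1)]
proof (induction i rule: wf_induct_rule)
  case (less i)
  then show ?case using assms(2)[of i] by (auto simp: underS_def)
qed

lemma least_pos:
  assumes "Well_order r" "P i"
  obtains j where "P j" "\<And>k. k \<in> underS r j \<Longrightarrow> \<not> P k"
proof -
  obtain j where "P j" "\<And>k. (k, j) \<in> r - Id \<Longrightarrow> \<not> P k"
    using wfE_min[OF Well_order_wf[OF assms(1)], of i "Collect P"] assms(2) by auto
  then show ?thesis using that by (auto simp: underS_def)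
qed

lemma underS_succ_pos:
  assumes "Well_order r" "succ_pos r j k"
  shows "underS r k = insert j (underS r j)"
proof (intro equalityI subsetI)
  fix m assume m: "m \<in> underS r k"
  have F: "m \<in> Field r" "j \<in> Field r"
    using m assms(2) by (auto simp: underS_def succ_pos_def Field_def)
  show "m \<in> insert j (underS r j)"
  proof (rule ccontr)
    assume "m \<notin> insert j (underS r j)"
    then have "(j, m) \<in> r - Id" using Well_order_total[OF assms(1) F(2,1)] by auto
    then have "(k, m) \<in> r" using assms(2) by (auto simp: succ_pos_def)
    then show False using m Well_order_antisym[OF assms(1)] by (auto simp: underS_def)
  qed
next
  fix m assume "m \<in> insert j (underS r j)"
  then show "m \<in> underS r k"
    using assms underS_trans[OF assms(1), of m j k] by (auto simp: succ_pos_def underS_def)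
qed

lemma succ_pos_exists:
  assumes "Well_order r" "j \<in> underS r m"
  obtains k where "succ_pos r j k" "(k, m) \<in> r"
proof -
  obtain k where k: "j \<in> underS r k" "\<And>l. l \<in> underS r k \<Longrightarrow> j \<notin> underS r l"
    using least_pos[OF assms(1), of "\<lambda>k. j \<in> underS r k" m] assms(2) by blast
  have least: "(k, l) \<in> r" if "j \<in> underS r l" for l
  proof -
    have "k \<in> Field r" "l \<in> Field r" using k(1) that by (auto simp: underS_def Field_def)
    then show ?thesis using Well_order_total[OF assms(1)] k(2) that by blast
  qed
  show ?thesis
  proof (rule that)
    show "succ_pos r j k" using k(1) least by (auto simp: succ_pos_def underS_def)
    show "(k, m) \<in> r" using least assms(2) by blast
  qed
qed

lemma pos_cases:
  assumes "Well_order r"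
  obtains "underS r i = {}" | j where "succ_pos r j i" | "limit_pos r i"
proof -
  consider "underS r i = {}" | "limit_pos r i"
    | j where "j \<in> underS r i" "\<And>k. k \<in> underS r i \<Longrightarrow> j \<notin> underS r k"
    unfolding limit_pos_def by blast
  then show ?thesis
  proof cases
    case (3 j)
    obtain k where k: "succ_pos r j k" "(k, i) \<in> r" using succ_pos_exists[OF assms 3(1)] by blast
    have "k = i" using k 3(2)[of k] by (auto simp: underS_def succ_pos_def)
    then show ?thesis using that k by blast
  qed (use that in blast)+
qed

section \<open>Ordinal sums, covering both \<open>plus_omega\<close> and
  \<open>plus_two\<close>\<close>

definition osum :: "'b rel \<Rightarrow> 'c rel \<Rightarrow> ('b + 'c) rel" where
  "osum s t = {(Inl x, Inl y) | x y. (x, y) \<in> s} \<union> {(Inl x, Inr y) | x y. x \<in> Field s \<and> y \<in> Field t}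
     \<union> {(Inr x, Inr y) | x y. (x, y) \<in> t}"

lemma osum_simps [simp]:
  "(Inl x, Inl x') \<in> osum s t \<longleftrightarrow> (x, x') \<in> s"
  "(Inr y, Inr y') \<in> osum s t \<longleftrightarrow> (y, y') \<in> t"
  "(Inl x, Inr y) \<in> osum s t \<longleftrightarrow> x \<in> Field s \<and> y \<in> Field t"
  "(Inr y, Inl x) \<notin> osum s t"
  by (auto simp: osum_def)

lemma Field_osum: "Field (osum s t) = Inl ` Field s \<union> Inr ` Field t"
proof (rule set_eqI)
  fix z show "z \<in> Field (osum s t) \<longleftrightarrow> z \<in> Inl ` Field s \<union> Inr ` Field t"
    by (cases z) (auto simp: osum_def Field_def Domain_iff Range_iff)
qed

lemma Well_order_osum:
  assumes s: "Well_order s" and t: "Well_order t"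
  shows "Well_order (osum s t)"
proof -
  let ?q = "osum s t"
  have "refl_on (Field ?q) ?q"
    unfolding refl_on_def Field_osum
    using Well_order_refl[OF s] Well_order_refl[OF t] by auto
  moreover have "trans ?q"
  proof (rule transI)
    fix x y z assume "(x, y) \<in> ?q" "(y, z) \<in> ?q"
    then show "(x, z) \<in> ?q"
      by (cases x; cases y; cases z)
        (auto intro: Well_order_trans[OF s] Well_order_trans[OF t] FieldI1 FieldI2)
  qed
  moreover have "antisym ?q"
  proof (rule antisymI)
    fix x y assume "(x, y) \<in> ?q" "(y, x) \<in> ?q"
    then show "x = y"
      by (cases x; cases y) (auto intro: Well_order_antisym[OF s] Well_order_antisym[OF t])
  qed
  moreover have "total_on (Field ?q) ?q"
  proof (rule total_onI)
    fix x y assume "x \<in> Field ?q" "y \<in> Field ?q"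
    then show "(x, y) \<in> ?q \<or> (y, x) \<in> ?q"
      unfolding Field_osum
      using Well_order_total[OF s] Well_order_total[OF t]
      by (cases x; cases y) (auto simp: underS_def)
  qed
  moreover have "wf (?q - Id)"
  proof -
    have inl: "P (Inl x)"
      if h: "\<And>z. (\<And>y. (y, z) \<in> ?q - Id \<Longrightarrow> P y) \<Longrightarrow> P z" for P :: "'a + 'b \<Rightarrow> bool" and x
      using s
    proof (induction x rule: underS_induct)
      case (less x)
      show ?case
      proof (rule h)
        fix y assume "(y, Inl x) \<in> ?q - Id"
        then show "P y" using less by (cases y) (auto simp: underS_def)
      qed
    qed
    have inr: "P (Inr x)"
      if h: "\<And>z. (\<And>y. (y, z) \<in> ?q - Id \<Longrightarrow> P y) \<Longrightarrow> P z" for P :: "'a + 'b \<Rightarrow> bool" and x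
      using t
    proof (induction x rule: underS_induct)
      case (less x)
      note Inl = inl[of P, OF h]
      show ?case
      proof (rule h)
        fix y assume "(y, Inr x) \<in> ?q - Id"
        then show "P y" using less Inl by (cases y) (auto simp: underS_def)
      qed
    qed
    show ?thesis
    proof (rule wfUNIVI)
      fix P :: "'a + 'b \<Rightarrow> bool" and z
      assume "\<forall>z. (\<forall>y. (y, z) \<in> ?q - Id \<longrightarrow> P y) \<longrightarrow> P z"
      then show "P z" using inl[of P] inr[of P] by (cases z) blast+
    qed
  qed
  moreover have "?q \<subseteq> Field ?q \<times> Field ?q" by (auto simp: Field_def)
  ultimately show ?thesis by (simp add: order_on_defs)
qed

lemma Field_le: "Field {(x, y). x \<le> (y :: 'b :: preorder)} = UNIV"
  by (auto simp: Field_def)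

lemma Well_order_le:
  assumes "wf {(x, y). x < (y :: 'b :: linorder)}"
  shows "Well_order {(x, y). x \<le> (y :: 'b)}"
proof -
  have "{(x, y). x \<le> (y :: 'b)} - Id = {(x, y). x < y}" by auto
  moreover have "refl {(x, y). x \<le> (y :: 'b)}" by (simp add: refl_on_def)
  moreover have "trans {(x, y). x \<le> (y :: 'b)}" by (rule transI) auto
  moreover have "antisym {(x, y). x \<le> (y :: 'b)}" by (rule antisymI) auto
  moreover have "total {(x, y). x \<le> (y :: 'b)}" by (rule total_onI) auto
  ultimately show ?thesis using assms by (simp add: Field_le order_on_defs)
qed

lemma wf_less_bool: "wf {(x, y). x < (y :: bool)}"
  by (rule wf_subset[OF wf_measure[of "\<lambda>b. if b then 1 else 0"]]) auto

lemma plus_omega_eq_osum: "plus_omega a = osum a {(m, n). m \<le> n}"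
  unfolding plus_omega_def osum_def Field_le by auto

lemma plus_two_eq_osum: "plus_two s = osum s {(b, c). b \<le> c}"
  unfolding plus_two_def osum_def Field_le by auto

lemma Well_order_plus_omega: "Well_order a \<Longrightarrow> Well_order (plus_omega a)"
  unfolding plus_omega_eq_osum by (rule Well_order_osum[OF _ Well_order_le[OF wf]])

lemma Well_order_plus_two: "Well_order s \<Longrightarrow> Well_order (plus_two s)"
  unfolding plus_two_eq_osum by (rule Well_order_osum[OF _ Well_order_le[OF wf_less_bool]])

lemma Field_plus_omega: "Field (plus_omega a) = Inl ` Field a \<union> range Inr"
  by (simp add: plus_omega_eq_osum Field_osum Field_le)

lemma Field_plus_two: "Field (plus_two s) = Inl ` Field s \<union> range Inr"
  unfolding plus_two_eq_osum Field_osum Field_le ..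

lemma underS_plus_omega [simp]:
  "underS (plus_omega a) (Inl x) = Inl ` underS a x"
  "underS (plus_omega a) (Inr n) = Inl ` Field a \<union> Inr ` {..<n}"
  by (auto simp: plus_omega_def underS_def)

lemma underS_plus_two [simp]:
  "underS (plus_two s) (Inl x) = Inl ` underS s x"
  "underS (plus_two s) (Inr False) = Inl ` Field s"
  by (auto simp: plus_two_def underS_def)

lemma succ_pos_plus_two_top: "succ_pos (plus_two s) (Inr False) (Inr True)"
  by (auto simp: succ_pos_def plus_two_def)

section \<open>The relations of the game\<close>

text \<open>One round of the game: in a pair (u, v) the robber is at u and the cop at v; the robber
  moves first and the cop must answer into \<open>X\<close>. Iterating this operator replaces taking
  successors of a position.\<close>

definition cop_step :: "'a set \<Rightarrow> ('a \<Rightarrow> 'a \<Rightarrow> bool) \<Rightarrow> 'a rel \<Rightarrow> 'a rel" where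
  "cop_step V E X = {(u, v). u \<in> V \<and> v \<in> V \<and> (\<forall>x\<in>cnbhd V E u. \<exists>y\<in>cnbhd V E v. (x, y) \<in> X)}"

lemma cop_step_iff:
  "(u, v) \<in> cop_step V E X \<longleftrightarrow>
    u \<in> V \<and> v \<in> V \<and> (\<forall>x\<in>cnbhd V E u. \<exists>y\<in>cnbhd V E v. (x, y) \<in> X)"
  by (simp add: cop_step_def)

lemma cop_step_mono: "X \<subseteq> Y \<Longrightarrow> cop_step V E X \<subseteq> cop_step V E Y"
  unfolding cop_step_def by blast

lemma cop_step_funpow_mono: "X \<subseteq> Y \<Longrightarrow> (cop_step V E ^^ n) X \<subseteq> (cop_step V E ^^ n) Y"
  by (induction n) (auto dest: cop_step_mono)

lemma cnbhd_subset: "v \<in> V \<Longrightarrow> cnbhd V E v \<subseteq> V"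
  by (auto simp: cnbhd_def)

lemma self_in_cnbhd: "v \<in> cnbhd V E v"
  by (simp add: cnbhd_def)

lemma cop_step_Times: "cop_step V E (V \<times> V) = V \<times> V"
  unfolding cop_step_def using cnbhd_subset[of _ V E] self_in_cnbhd[of _ V E] by blast

lemma Id_on_subset_cop_step: "Id_on V \<subseteq> X \<Longrightarrow> Id_on V \<subseteq> cop_step V E X"
  unfolding cop_step_def using cnbhd_subset[of _ V E] by blast

lemma crle_rec:
  assumes "Well_order r"
  shows "crle V E r i =
    (if underS r i = {} then Id_on V else cop_step V E (\<Union>j\<in>underS r i. crle V E r j))"
proof -
  have *: "cut (crle V E r) (r - Id) i j = crle V E r j" if "(j, i) \<in> r - Id" for j
    using that by (simp add: cut_apply)
  have "crle V E r i = (if (\<exists>j. (j, i) \<in> r - Id)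
     then {(u, v). u \<in> V \<and> v \<in> V \<and>
             (\<forall>x\<in>cnbhd V E u. \<exists>y\<in>cnbhd V E v. \<exists>j. (j, i) \<in> r - Id \<and> (x, y) \<in> cut (crle V E r) (r - Id) i j)}
     else {(u, v). u \<in> V \<and> v \<in> V \<and> u = v})"
    by (subst crle_def, subst wfrec[OF Well_order_wf[OF assms]], fold crle_def) (rule refl)
  also have "\<dots> = (if underS r i = {} then Id_on V
      else cop_step V E (\<Union>j\<in>underS r i. crle V E r j))"
  proof (cases "underS r i = {}")
    case True
    then have "\<not> (\<exists>j. (j, i) \<in> r - Id)" by (auto simp: underS_def)
    then show ?thesis using True by auto
  next
    case False
    then have ex: "\<exists>j. (j, i) \<in> r - Id" by (auto simp: underS_def)
    have "(\<exists>j. (j, i) \<in> r - Id \<and> p \<in> cut (crle V E r) (r - Id) i j)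
        \<longleftrightarrow> p \<in> (\<Union>j\<in>underS r i. crle V E r j)" for p
      using * by (auto simp: underS_def)
    then show ?thesis using False ex by (simp add: cop_step_def)
  qed
  finally show ?thesis .
qed

section \<open>Stages of the transfinite recursion\<close>

lemma crle_min: "Well_order r \<Longrightarrow> underS r i = {} \<Longrightarrow> crle V E r i = Id_on V"
  by (simp add: crle_rec)

lemma crle_nonmin:
  "Well_order r \<Longrightarrow> underS r i \<noteq> {} \<Longrightarrow>
    crle V E r i = cop_step V E (\<Union>j\<in>underS r i. crle V E r j)"
  by (simp add: crle_rec)

lemma crle_subset: "Well_order r \<Longrightarrow> crle V E r i \<subseteq> V \<times> V"
  by (subst crle_rec) (auto simp: cop_step_def)

lemma Id_on_subset_crle:
  assumes "Well_order r" shows "Id_on V \<subseteq> crle V E r i"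
  using assms
proof (induction i rule: underS_induct)
  case (less i)
  show ?case
  proof (cases "underS r i = {}")
    case True
    then show ?thesis by (simp add: crle_min[OF assms])
  next
    case False
    then show ?thesis
      unfolding crle_nonmin[OF assms False] using less by (intro Id_on_subset_cop_step) blast
  qed
qed

lemma crle_mono:
  assumes "Well_order r" "(i, j) \<in> r"
  shows "crle V E r i \<subseteq> crle V E r j"
proof (cases "underS r i = {}")
  case True
  then show ?thesis by (simp add: crle_min[OF assms(1)] Id_on_subset_crle[OF assms(1)])
next
  case False
  have sub: "underS r i \<subseteq> underS r j" using underS_trans[OF assms(1) _ assms(2)] by blast
  with False have "underS r j \<noteq> {}" by blast
  then show ?thesis
    unfolding crle_nonmin[OF assms(1) False] crle_nonmin[OF assms(1) \<open>underS r j \<noteq> {}\<close>]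
    using sub by (intro cop_step_mono) blast
qed

lemma Union_underS_succ_pos:
  assumes "Well_order r" "succ_pos r j k" "\<And>i j. (i, j) \<in> r \<Longrightarrow> f i \<subseteq> f j"
  shows "(\<Union>i\<in>underS r k. f i) = f j"
  using assms(3) unfolding underS_succ_pos[OF assms(1,2)] by (fastforce simp: underS_def)

lemma crle_succ_pos:
  assumes "Well_order r" "succ_pos r j k"
  shows "crle V E r k = cop_step V E (crle V E r j)"
proof -
  have ne: "underS r k \<noteq> {}" using underS_succ_pos[OF assms] by blast
  show ?thesis
    unfolding crle_nonmin[OF assms(1) ne]
    by (rule arg_cong[OF Union_underS_succ_pos[OF assms]]) (rule crle_mono[OF assms(1)])
qed

text \<open>Equality with the next stage makes the stage a fixed point of \<open>cop_step\<close>;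
  by induction the union of the stages below any later position is that same relation, also at
  limits.\<close>

lemma crle_stable:
  assumes "Well_order r" "succ_pos r j k" "crle V E r j = crle V E r k" "(j, i) \<in> r"
  shows "crle V E r i = crle V E r j"
  using assms(1,4)
proof (induction i rule: underS_induct)
  case (less i)
  show ?case
  proof (cases "i = j")
    case False
    then have j: "j \<in> underS r i" using less.prems by (auto simp: underS_def)
    have "crle V E r m \<subseteq> crle V E r j" if "m \<in> underS r i" for m
    proof -
      have "(j, m) \<in> r \<or> m \<in> underS r j"
        using Well_order_total[OF assms(1), of j m] that j by (auto simp: underS_def Field_def)
      then show ?thesis
      proof
        assume "(j, m) \<in> r"
        then show ?thesis using less.IH[OF that] by blast
      next
        assume "m \<in> underS r j"
        then show ?thesis by (intro crle_mono[OF assms(1)]) (simp add: underS_def)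
      qed
    qed
    then have eq: "(\<Union>m\<in>underS r i. crle V E r m) = crle V E r j" using j by blast
    have ne: "underS r i \<noteq> {}" using j by blast
    show ?thesis
      unfolding crle_nonmin[OF assms(1) ne] eq crle_succ_pos[OF assms(1,2), symmetric]
      by (rule assms(3)[symmetric])
  qed simp
qed

lemma crle_finite_pos:
  assumes "Well_order r" "finite (underS r i)"
  shows "crle V E r i = (cop_step V E ^^ card (underS r i)) (Id_on V)"
  using assms
proof (induction i rule: underS_induct)
  case (less i)
  from assms(1) show ?case
  proof (cases rule: pos_cases[where i = i])
    case 1
    then show ?thesis by (simp add: crle_min[OF assms(1)])
  next
    case (2 j)
    have j: "underS r i = insert j (underS r j)" "j \<notin> underS r j"
      using underS_succ_pos[OF assms(1) 2] by (auto simp: underS_def)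
    then show ?thesis
      using less crle_succ_pos[OF assms(1) 2, of V E] by simp
  next
    case 3
    \<comment> \<open>This case is contradictory: among finitely many predecessors take one with the
      most predecessors of its own; a limit position has another one above it, with more.\<close>
    let ?c = "\<lambda>j. card (underS r j)"
    have "Max (?c ` underS r i) \<in> ?c ` underS r i"
      using less.prems 3 by (intro Max_in) (auto simp: limit_pos_def)
    then obtain j where j: "j \<in> underS r i" "?c j = Max (?c ` underS r i)" by force
    then obtain k where k: "k \<in> underS r i" "j \<in> underS r k" using 3 by (auto simp: limit_pos_def)
    have "underS r j \<subset> underS r k"
      using k(2) underS_trans[OF assms(1), of _ j k] by (auto simp: underS_def)
    moreover have "finite (underS r k)"
    proof (rule finite_subset[OF _ less.prems])
      have "(k, i) \<in> r" using k(1) by (simp add: underS_def)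
      then show "underS r k \<subseteq> underS r i" using underS_trans[OF assms(1)] by blast
    qed
    ultimately have "?c j < ?c k" by (rule psubset_card_mono[rotated])
    moreover have "?c k \<le> Max (?c ` underS r i)" using less.prems k(1) by simp
    ultimately show ?thesis using j(2) by simp
  qed
qed

text \<open>The recursion reads a position only through the positions below it. This transports a
  computation in \<open>plus_omega a\<close> into \<open>plus_two s\<close> when the two orders are
  merely isomorphic.\<close>

lemma crle_initial_segment:
  assumes "Well_order q" "Well_order r"
    and "\<And>i. i \<in> Field q \<Longrightarrow> underS r (g i) = g ` underS q i"
    and "i \<in> Field q"
  shows "crle V E r (g i) = crle V E q i"
  using assms(1,4)
proof (induction i rule: underS_induct)
  case (less i)
  have "crle V E r (g j) = crle V E q j" if "j \<in> underS q i" for j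
    by (rule less.IH[OF that]) (use that in \<open>auto simp: underS_def Field_def\<close>)
  then have eq: "(\<Union>j\<in>underS r (g i). crle V E r j) = (\<Union>j\<in>underS q i. crle V E q j)"
    unfolding assms(3)[OF less.prems] by simp
  show ?case
    unfolding crle_rec[OF assms(2), of V E "g i"] eq crle_rec[OF assms(1), of V E i]
    by (simp add: assms(3)[OF less.prems])
qed

section \<open>Criteria for being the CR-ordinal\<close>

lemma is_CR_ordinal_iff:
  "is_CR_ordinal V E s \<longleftrightarrow> Well_order s \<and>
     crle V E (plus_two s) (Inr False) = crle V E (plus_two s) (Inr True) \<and>
     (\<forall>j\<in>Field s. \<forall>k. succ_pos (plus_two s) (Inl j) k \<longrightarrow>
        crle V E (plus_two s) (Inl j) \<noteq> crle V E (plus_two s) k)"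
proof -
  have *: "(j, Inr False) \<in> plus_two s - Id \<longleftrightarrow> (\<exists>i\<in>Field s. j = Inl i)" for j
    by (auto simp: plus_two_def)
  show ?thesis unfolding is_CR_ordinal_def Let_def succ_pos_def[symmetric] * by fastforce
qed

text \<open>For the third fact: \<open>cop_step\<close> fixes V \<times> V, so a total stage would
  equal its successor, against the minimality of \<open>s\<close>.\<close>

lemma is_CR_ordinalD:
  assumes "is_CR_ordinal V E s"
  shows "Well_order s"
    and "cop_step V E (crle V E (plus_two s) (Inr False)) = crle V E (plus_two s) (Inr False)"
    and "\<And>j. j \<in> Field s \<Longrightarrow> crle V E (plus_two s) (Inl j) \<noteq> V \<times> V"
proof -
  show wo: "Well_order s" using assms by (simp add: is_CR_ordinal_iff)
  note wo2 = Well_order_plus_two[OF wo]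
  show "cop_step V E (crle V E (plus_two s) (Inr False)) = crle V E (plus_two s) (Inr False)"
    using assms crle_succ_pos[OF wo2 succ_pos_plus_two_top, of V E] by (simp add: is_CR_ordinal_iff)
  fix j assume j: "j \<in> Field s"
  then obtain k where k: "succ_pos (plus_two s) (Inl j) k"
    using succ_pos_exists[OF wo2, of "Inl j" "Inr False"] by auto
  show "crle V E (plus_two s) (Inl j) \<noteq> V \<times> V"
    using assms j k crle_succ_pos[OF wo2 k, of V E] cop_step_Times[of V E]
    unfolding is_CR_ordinal_iff by metis
qed

text \<open>An earlier stall would persist by \<open>crle_stable\<close>, so the stage at the end
  would not be larger than the stalled one. As the end is total, minimality reduces to no earlier
  stage being total.\<close>

lemma is_CR_ordinalI:
  assumes "Well_order s" "crle V E (plus_two s) (Inr False) = V \<times> V"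
    and "\<And>j. j \<in> Field s \<Longrightarrow> crle V E (plus_two s) (Inl j) \<noteq> V \<times> V"
  shows "is_CR_ordinal V E s"
proof -
  note wo2 = Well_order_plus_two[OF assms(1)]
  have "crle V E (plus_two s) (Inr True) = V \<times> V"
    using crle_succ_pos[OF wo2 succ_pos_plus_two_top, of V E] assms(2) cop_step_Times[of V E] by simp
  moreover have "crle V E (plus_two s) (Inl j) \<noteq> crle V E (plus_two s) k"
    if "j \<in> Field s" "succ_pos (plus_two s) (Inl j) k" for j k
  proof -
    have "(Inl j, Inr False) \<in> plus_two s" using that(1) by (auto simp: plus_two_def)
    then show ?thesis using crle_stable[OF wo2 that(2), of V E "Inr False"] assms(2,3) that(1) by metis
  qed
  ultimately show ?thesis using assms(1,2) by (simp add: is_CR_ordinal_iff)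
qed

section \<open>Branches of a tree\<close>

lemma rtrancl_distinct_path:
  assumes "(u, x) \<in> {(a, b). R a b}\<^sup>*"
  obtains xs where "xs \<noteq> []" "hd xs = u" "last xs = x" "distinct xs"
    "\<And>i. Suc i < length xs \<Longrightarrow> R (xs ! i) (xs ! Suc i)"
proof -
  from assms have "\<exists>xs. xs \<noteq> [] \<and> hd xs = u \<and> last xs = x \<and> distinct xs \<and>
    (\<forall>i. Suc i < length xs \<longrightarrow> R (xs ! i) (xs ! Suc i))"
  proof (induction rule: rtrancl_induct)
    case base
    show ?case by (rule exI[of _ "[u]"]) simp
  next
    case (step y z)
    then obtain xs where xs: "xs \<noteq> []" "hd xs = u" "last xs = y" "distinct xs"
      "\<forall>i. Suc i < length xs \<longrightarrow> R (xs ! i) (xs ! Suc i)" by blast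
    show ?case
    proof (cases "z \<in> set xs")
      case True
      then obtain n where n: "n < length xs" "xs ! n = z" by (auto simp: in_set_conv_nth)
      let ?ys = "take (Suc n) xs"
      have "last ?ys = z" using n by (simp add: take_Suc_conv_app_nth)
      then show ?thesis using xs n by (intro exI[of _ ?ys]) (auto simp: hd_take)
    next
      case False
      have "R ((xs @ [z]) ! i) ((xs @ [z]) ! Suc i)" if "Suc i < length (xs @ [z])" for i
      proof (cases "Suc i < length xs")
        case True
        then show ?thesis using xs(5) by (simp add: nth_append)
      next
        case False
        then have "i = length xs - 1" "Suc i = length xs" using that by auto
        then show ?thesis using xs(1,3) step.hyps(2) by (simp add: nth_append last_conv_nth)
      qed
      then show ?thesis using xs False by (intro exI[of _ "xs @ [z]"]) auto
    qed
  qed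
  then show ?thesis using that by blast
qed

text \<open>For an edge u v of a tree this is the component containing u after v is deleted.\<close>

definition branch :: "('a \<Rightarrow> 'a \<Rightarrow> bool) \<Rightarrow> 'a \<Rightarrow> 'a \<Rightarrow> 'a set" where
  "branch E u v = {x. (u, x) \<in> {(a, b). E a b \<and> a \<noteq> v \<and> b \<noteq> v}\<^sup>*}"

lemma branch_root: "u \<in> branch E u v"
  by (simp add: branch_def)

lemma branch_step:
  assumes "x \<in> branch E u v" "E x y" "x \<noteq> v" "y \<noteq> v"
  shows "y \<in> branch E u v"
  using assms unfolding branch_def by (auto intro: rtrancl_into_rtrancl)

lemma branch_induct [consumes 1, case_names root step]:
  assumes "x \<in> branch E u v" "P u"
    and "\<And>x y. x \<in> branch E u v \<Longrightarrow> P x \<Longrightarrow> E x y \<Longrightarrow> x \<noteq> v \<Longrightarrow> y \<noteq> v \<Longrightarrow> P y"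
  shows "P x"
proof -
  have "(u, x) \<in> {(a, b). E a b \<and> a \<noteq> v \<and> b \<noteq> v}\<^sup>*" using assms(1) by (simp add: branch_def)
  then show ?thesis
  proof (induction rule: rtrancl_induct)
    case (step y z)
    then show ?case using assms(3)[of y z] by (simp add: branch_def)
  qed (rule assms(2))
qed

locale tree_graph =
  fixes V :: "'a set" and E :: "'a \<Rightarrow> 'a \<Rightarrow> bool"
  assumes tree: "tree V E"
begin

lemma edgeD: "E u v \<Longrightarrow> u \<in> V" "E u v \<Longrightarrow> v \<in> V" "E u v \<Longrightarrow> u \<noteq> v" "E u v \<Longrightarrow> E v u"
  using tree unfolding tree_def simple_graph_def by blast+

lemma cnbhd_iff: "u \<in> cnbhd V E v \<longleftrightarrow> u = v \<or> E v u"
  using edgeD(2) by (auto simp: cnbhd_def)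

lemma connected_induct:
  assumes "x \<in> V" "y \<in> V" "P x" "\<And>u v. P u \<Longrightarrow> E u v \<Longrightarrow> P v"
  shows "P y"
proof -
  have "(x, y) \<in> {(x, y). E x y}\<^sup>*"
    using tree assms(1,2) by (simp add: tree_def connected_graph_def)
  then show ?thesis by (induction rule: rtrancl_induct) (auto intro: assms(3,4))
qed

lemma apex_notin_branch:
  assumes "E u v" shows "v \<notin> branch E u v"
proof -
  have "x \<noteq> v" if "x \<in> branch E u v" for x
    using that by (induction rule: branch_induct) (use edgeD(3)[OF assms] in auto)
  then show ?thesis by blast
qed

lemma branch_subset: "x \<in> branch E u v \<Longrightarrow> u \<in> V \<Longrightarrow> x \<in> V"
  by (induction rule: branch_induct) (auto dest: edgeD)

text \<open>Otherwise a simple path from u to x avoiding v closes up through v to a cycle. This is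
  where acyclicity enters; the other facts on branches rest on it.\<close>

lemma neighbour_in_branch:
  assumes "E u v" "E x v" "x \<in> branch E u v"
  shows "x = u"
proof (rule ccontr)
  assume "x \<noteq> u"
  have "(u, x) \<in> {(a, b). E a b \<and> a \<noteq> v \<and> b \<noteq> v}\<^sup>*" using assms(3) by (simp add: branch_def)
  then obtain xs where xs: "xs \<noteq> []" "hd xs = u" "last xs = x" "distinct xs"
    and path: "\<And>i. Suc i < length xs \<Longrightarrow> E (xs ! i) (xs ! Suc i) \<and> xs ! i \<noteq> v \<and> xs ! Suc i \<noteq> v"
    by (rule rtrancl_distinct_path) (rule that)
  have len: "2 \<le> length xs"
  proof -
    have "length xs \<noteq> 0" "length xs \<noteq> 1" using xs \<open>x \<noteq> u\<close> by (auto simp: length_Suc_conv)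
    then show ?thesis by linarith
  qed
  have avoid: "xs ! i \<noteq> v \<and> xs ! i \<in> V" if "i < length xs" for i
  proof (cases i)
    case 0
    then show ?thesis using path[of 0] edgeD(1) len by auto
  next
    case (Suc j)
    then show ?thesis using path[of j] edgeD(2) that by auto
  qed
  have "has_cycle V E"
    unfolding has_cycle_def
  proof (intro exI[of _ "v # xs"] conjI allI impI)
    show "3 \<le> length (v # xs)" using len by simp
    show "distinct (v # xs)" using xs(4) avoid by (auto simp: in_set_conv_nth)
    show "set (v # xs) \<subseteq> V" using avoid edgeD(2)[OF assms(1)] by (auto simp: in_set_conv_nth)
    show "E (last (v # xs)) (hd (v # xs))" using xs assms(2) by simp
    fix i assume i: "Suc i < length (v # xs)"
    show "E ((v # xs) ! i) ((v # xs) ! Suc i)"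
    proof (cases i)
      case 0
      then show ?thesis using edgeD(4)[OF assms(1)] xs by (simp add: hd_conv_nth)
    next
      case (Suc j)
      then show ?thesis using path[of j] i by simp
    qed
  qed
  then show False using tree by (simp add: tree_def)
qed

lemma branch_neighbour:
  assumes "E u v" "x \<in> branch E u v" "E x y"
  shows "y \<in> branch E u v \<or> x = u \<and> y = v"
proof (cases "y = v")
  case True
  then show ?thesis using neighbour_in_branch assms by blast
next
  case False
  moreover have "x \<noteq> v" using apex_notin_branch[OF assms(1)] assms(2) by blast
  ultimately show ?thesis using branch_step[OF assms(2,3)] by blast
qed

lemma branch_subset_branch:
  assumes "E w u" "E u v" "w \<noteq> v" "x \<in> branch E w u"
  shows "x \<in> branch E u v"
  using assms(4)
proof (induction rule: branch_induct)
  case root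
  show ?case
    using branch_step[OF branch_root[of u E v] edgeD(4)[OF assms(1)]] edgeD(3)[OF assms(2)] assms(3)
    by blast
next
  case (step x y)
  then have y: "y \<in> branch E w u" using branch_step[of x E w u y] by blast
  have "y \<noteq> v" using neighbour_in_branch[OF assms(1) edgeD(4)[OF assms(2)]] y assms(3) by blast
  moreover have "x \<noteq> v" using apex_notin_branch[OF assms(2)] step by blast
  ultimately show ?case using branch_step[of x E u v y] step by blast
qed

lemma branch_cases:
  assumes "E u v" "x \<in> branch E u v" "x \<noteq> u"
  obtains w where "E w u" "w \<noteq> v" "x \<in> branch E w u"
proof -
  from assms(2) have "x = u \<or> (\<exists>w. E w u \<and> w \<noteq> v \<and> x \<in> branch E w u)"
  proof (induction rule: branch_induct)
    case (step x y)
    show ?case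
    proof (cases "x = u \<or> y = u")
      case True
      then show ?thesis using step edgeD(4) branch_root[of y E u] by blast
    next
      case False
      then show ?thesis using step branch_step[of x E _ u y] by blast
    qed
  qed simp
  then show ?thesis using assms(3) that by blast
qed

lemma branch_exists:
  assumes "u \<in> V" "v \<in> V" "u \<noteq> v"
  obtains w where "E w v" "u \<in> branch E w v"
proof -
  have "u = v \<or> (\<exists>w. E w v \<and> u \<in> branch E w v)"
  proof (rule connected_induct[OF assms(2,1)])
    fix x y assume *: "x = v \<or> (\<exists>w. E w v \<and> x \<in> branch E w v)" "E x y"
    show "y = v \<or> (\<exists>w. E w v \<and> y \<in> branch E w v)"
    proof (cases "x = v \<or> y = v")
      case True
      then show ?thesis using * edgeD(4) branch_root[of y E v] by blast
    next
      case False
      then show ?thesis using * branch_step[of x E _ v y] by blast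
    qed
  qed simp
  then show ?thesis using assms(3) that by blast
qed

lemma branch_sym: "x \<in> branch E u v \<Longrightarrow> u \<in> branch E x v"
proof (induction rule: branch_induct)
  case root
  show ?case by (rule branch_root)
next
  case (step x y)
  have "{(a, b). E a b \<and> a \<noteq> v \<and> b \<noteq> v}\<^sup>* `` {x} \<subseteq> {(a, b). E a b \<and> a \<noteq> v \<and> b \<noteq> v}\<^sup>* `` {y}"
    using step.hyps edgeD(4)[of x y] by (auto intro: converse_rtrancl_into_rtrancl)
  then show ?case using step.IH by (auto simp: branch_def)
qed

lemma branches_disjoint:
  assumes "E u v" "E u' v" "x \<in> branch E u v" "x \<in> branch E u' v"
  shows "u = u'"
proof -
  have "u' \<in> branch E x v" using branch_sym[OF assms(4)] .
  then have "u' \<in> branch E u v"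
    using assms(3) unfolding branch_def by (auto intro: rtrancl_trans)
  then show ?thesis using neighbour_in_branch[OF assms(1,2)] by blast
qed

end

section \<open>A cop-win tree has no ray\<close>

text \<open>An arc (u, v) stands for a robber at u with a cop on the neighbour v; the robber's only
  sensible moves lead to arcs (x, u) with x a neighbour of u other than v.\<close>

definition next_arc :: "('a \<Rightarrow> 'a \<Rightarrow> bool) \<Rightarrow> ('a \<times> 'a) rel" where
  "next_arc E = {((x, u), (u, v)) | x u v. E x u \<and> E u v \<and> x \<noteq> v}"

text \<open>The cop's move depends on its own earlier moves through \<open>history\<close>, so the
  histories are built by recursion and the moves are read off from them.\<close>

lemma play_exists:
  obtains c where "c 0 = \<sigma> []" "\<And>n. c (Suc n) = \<sigma> (history c r n)"
proof -
  define h where "h = rec_nat [\<sigma> [], r 0] (\<lambda>n xs. xs @ [\<sigma> xs, r (Suc n)])"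
  define c where "c n = (case n of 0 \<Rightarrow> \<sigma> [] | Suc m \<Rightarrow> \<sigma> (h m))" for n
  have "history c r n = h n" for n
    by (induction n) (simp_all add: history_def h_def c_def)
  then show ?thesis using that[of c] by (simp add: c_def)
qed

context tree_graph
begin

text \<open>A cop that enters the branch of w comes from that branch or from u, and both lie in the
  branch of u, where the cop was not. So a robber running away from the cop keeps it behind; this
  serves the actual game as well as the relations \<open>crle\<close>.\<close>

lemma arc_shift:
  assumes "E w u" "E u v" "w \<noteq> v" "c \<notin> branch E u v" "c' \<in> cnbhd V E c"
  shows "c' \<notin> branch E w u"
proof
  assume c': "c' \<in> branch E w u"
  then have "c' \<in> branch E u v" using branch_subset_branch[OF assms(1-3)] by blast
  then have "E c c'" using assms(4,5) by (auto simp: cnbhd_iff)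
  then consider "c \<in> branch E w u" | "c = u"
    using branch_neighbour[OF assms(1) c' edgeD(4)] by blast
  then show False
    using branch_subset_branch[OF assms(1-3)] branch_root[of u E v] assms(4) by cases auto
qed

lemma cop_win_imp_wf_next_arc:
  assumes "cop_win V E"
  shows "wf (next_arc E)"
proof (rule ccontr)
  assume "\<not> wf (next_arc E)"
  then obtain f where f: "\<And>i. (f (Suc i), f i) \<in> next_arc E"
    by (auto simp: wf_iff_no_infinite_down_chain)
  define a where "a i = snd (f i)" for i
  have fst: "fst (f i) = a (Suc i)" for i using f[of i] by (auto simp: next_arc_def a_def)
  have a: "E (a (Suc i)) (a i)" "a (Suc (Suc i)) \<noteq> a i" for i
    using f[of i] fst[of i] fst[of "Suc i"] by (auto simp: next_arc_def a_def)
  obtain \<sigma> where \<sigma>: "\<sigma> [] \<in> V" and win: "\<And>c r. c 0 = \<sigma> [] \<Longrightarrow> (\<And>n. c (Suc n) = \<sigma> (history c r n)) \<Longrightarrow>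
      r 0 \<in> V \<Longrightarrow> (\<And>n. r (Suc n) \<in> cnbhd V E (r n)) \<Longrightarrow>
      \<exists>n. (\<forall>m\<le>n. c (Suc m) \<in> cnbhd V E (c m)) \<and> (c n = r n \<or> c (Suc n) = r n)"
    using assms unfolding cop_win_def by auto
  \<comment> \<open>A vertex lying in all these branches is none of the vertices a (i + 1), so its
    neighbours cannot leave the branches either. Connectivity would then put a 0 into the branch of
    which it is the apex.\<close>
  have "\<exists>i. \<sigma> [] \<notin> branch E (a (Suc i)) (a i)"
  proof (rule ccontr)
    assume "\<not> ?thesis"
    then have all: "\<forall>i. \<sigma> [] \<in> branch E (a (Suc i)) (a i)" by blast
    have "a 0 \<in> V" using a(1) edgeD(2) by blast
    then have "\<forall>i. a 0 \<in> branch E (a (Suc i)) (a i)"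
    proof (rule connected_induct[OF \<sigma>])
      show "\<forall>i. \<sigma> [] \<in> branch E (a (Suc i)) (a i)" by (rule all)
      fix x y assume x: "\<forall>i. x \<in> branch E (a (Suc i)) (a i)" and xy: "E x y"
      show "\<forall>i. y \<in> branch E (a (Suc i)) (a i)"
      proof
        fix i
        have "x \<noteq> a (Suc i)" using x apex_notin_branch[OF a(1)] by metis
        then show "y \<in> branch E (a (Suc i)) (a i)" using branch_neighbour[OF a(1) _ xy] x by blast
      qed
    qed
    then show False using apex_notin_branch[OF a(1)] by blast
  qed
  then obtain i where i: "\<sigma> [] \<notin> branch E (a (Suc i)) (a i)" by blast
  \<comment> \<open>The shift by two keeps the robber beyond the cop's present position and also
    beyond its next one, as either may decide the capture.\<close>
  define r where "r n = a (Suc (Suc (i + n)))" for n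
  obtain c where c: "c 0 = \<sigma> []" "\<And>n. c (Suc n) = \<sigma> (history c r n)"
    using play_exists[of \<sigma> r] by blast
  have "r 0 \<in> V" using a(1) edgeD(1) by (auto simp: r_def)
  moreover have "r (Suc n) \<in> cnbhd V E (r n)" for n
    using a(1)[of "Suc (Suc (i + n))"] edgeD(4) by (auto simp: r_def cnbhd_iff)
  ultimately obtain n where legal: "\<forall>m\<le>n. c (Suc m) \<in> cnbhd V E (c m)"
    and caught: "c n = r n \<or> c (Suc n) = r n"
    using win[OF c] by blast
  have behind: "c m \<notin> branch E (a (Suc (i + m))) (a (i + m))" if "m \<le> Suc n" for m
    using that
  proof (induction m)
    case 0
    then show ?case using i c(1) by simp
  next
    case (Suc m)
    then show ?case using arc_shift[OF a(1) a(1) a(2), of "c m" "i + m" "c (Suc m)"] legal by simp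
  qed
  have "r n \<in> branch E (a (Suc (Suc (i + n)))) (a (Suc (i + n)))"
    by (simp add: r_def branch_root)
  then show False
    using behind[of n] behind[of "Suc n"] caught
      branch_subset_branch[OF a(1) a(1) a(2), of "r n" "i + n"] by auto
qed

end

section \<open>Ranks of arcs\<close>

definition arc_step :: "('a \<Rightarrow> 'a \<Rightarrow> bool) \<Rightarrow> 'a rel \<Rightarrow> 'a rel" where
  "arc_step E X = {(u, v). E u v \<and> (\<forall>x. E x u \<longrightarrow> x \<noteq> v \<longrightarrow> (x, u) \<in> X)}"

text \<open>The arcs whose rank in the well-founded part of \<open>next_arc\<close> is at most the
  ordinal of the position. Arcs without continuation have rank 0, so
  \<open>(arc_step E ^^ n) {}\<close> holds the arcs of rank below n, not at most n.\<close>

definition arc_rank :: "('a \<Rightarrow> 'a \<Rightarrow> bool) \<Rightarrow> 'b rel \<Rightarrow> 'b \<Rightarrow> 'a rel" where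
  "arc_rank E r = wfrec (r - Id) (\<lambda>f i. arc_step E (\<Union>j\<in>underS r i. f j))"

text \<open>A bound on the tree rooted at \<open>v\<close>, in the form in which it is carried from
  one root to another.\<close>

definition arcs_into :: "('a \<Rightarrow> 'a \<Rightarrow> bool) \<Rightarrow> 'a rel \<Rightarrow> 'a \<Rightarrow> bool" where
  "arcs_into E X v \<longleftrightarrow> (\<forall>x. E x v \<longrightarrow> (x, v) \<in> X)"

lemma arc_step_iff:
  "(u, v) \<in> arc_step E X \<longleftrightarrow> E u v \<and> (\<forall>x. E x u \<longrightarrow> x \<noteq> v \<longrightarrow> (x, u) \<in> X)"
  by (simp add: arc_step_def)

lemma arc_step_mono: "X \<subseteq> Y \<Longrightarrow> arc_step E X \<subseteq> arc_step E Y"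
  unfolding arc_step_def by blast

lemma arc_step_edge: "(u, v) \<in> arc_step E X \<Longrightarrow> E u v"
  by (simp add: arc_step_iff)

lemma arc_step_funpow_closed:
  assumes "X \<subseteq> arc_step E X"
  shows "(arc_step E ^^ n) X \<subseteq> arc_step E ((arc_step E ^^ n) X)"
  by (induction n) (use assms in \<open>auto dest: arc_step_mono\<close>)

lemma arc_step_funpow_le:
  assumes "X \<subseteq> arc_step E X" "m \<le> n"
  shows "(arc_step E ^^ m) X \<subseteq> (arc_step E ^^ n) X"
  by (rule lift_Suc_mono_le[OF _ assms(2)]) (use arc_step_funpow_closed[OF assms(1)] in simp)

lemma arcs_into_mono: "arcs_into E X v \<Longrightarrow> X \<subseteq> Y \<Longrightarrow> arcs_into E Y v"
  unfolding arcs_into_def by blast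

lemma arc_rank_rec:
  assumes "Well_order r"
  shows "arc_rank E r i = arc_step E (\<Union>j\<in>underS r i. arc_rank E r j)"
proof -
  have "(\<Union>j\<in>underS r i. cut (arc_rank E r) (r - Id) i j) = (\<Union>j\<in>underS r i. arc_rank E r j)"
    by (rule SUP_cong) (auto simp: underS_def cut_apply)
  then show ?thesis
    by (subst arc_rank_def, subst wfrec[OF Well_order_wf[OF assms]], fold arc_rank_def) simp
qed

lemma arc_rank_mono:
  assumes "Well_order r" "(i, j) \<in> r"
  shows "arc_rank E r i \<subseteq> arc_rank E r j"
proof -
  have "underS r i \<subseteq> underS r j" using underS_trans[OF assms(1) _ assms(2)] by blast
  then show ?thesis
    unfolding arc_rank_rec[OF assms(1), of E i] arc_rank_rec[OF assms(1), of E j]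
    by (intro arc_step_mono) blast
qed

lemma arc_rank_below:
  assumes "Well_order r"
  shows "(\<Union>j\<in>underS r i. arc_rank E r j) \<subseteq> arc_rank E r i"
proof (rule UN_least)
  fix j assume "j \<in> underS r i"
  then show "arc_rank E r j \<subseteq> arc_rank E r i"
    by (intro arc_rank_mono[OF assms]) (simp add: underS_def)
qed

lemma arc_rank_closed: "Well_order r \<Longrightarrow> arc_rank E r i \<subseteq> arc_step E (arc_rank E r i)"
  using arc_step_mono[OF arc_rank_below] arc_rank_rec by metis

lemma arc_rank_succ_pos:
  assumes "Well_order r" "succ_pos r j k"
  shows "arc_rank E r k = arc_step E (arc_rank E r j)"
  unfolding arc_rank_rec[OF assms(1), of E k]
  by (rule arg_cong[OF Union_underS_succ_pos[OF assms]]) (rule arc_rank_mono[OF assms(1)])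

lemma limit_pos_succ:
  assumes "Well_order r" "limit_pos r i" "j \<in> underS r i"
  obtains k where "succ_pos r j k" "k \<in> underS r i"
proof -
  obtain m where m: "m \<in> underS r i" "j \<in> underS r m"
    using assms(2,3) by (auto simp: limit_pos_def)
  obtain k where "succ_pos r j k" "(k, m) \<in> r" using succ_pos_exists[OF assms(1) m(2)] .
  then show ?thesis using that underS_trans'[OF assms(1) _ m(1)] by blast
qed

text \<open>Successors of positions below a limit stay below it. Used to find a branch of rank at
  least a given finite number, hence with vertices at that distance.\<close>

lemma arc_rank_finite_pos:
  assumes "Well_order r" "limit_pos r i"
  obtains j where "j \<in> underS r i" "(arc_step E ^^ n) {} \<subseteq> arc_rank E r j"
proof -
  have "\<exists>j\<in>underS r i. (arc_step E ^^ n) {} \<subseteq> arc_rank E r j"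
  proof (induction n)
    case 0
    then show ?case using assms(2) by (auto simp: limit_pos_def)
  next
    case (Suc n)
    then obtain j where j: "j \<in> underS r i" "(arc_step E ^^ n) {} \<subseteq> arc_rank E r j" by blast
    obtain k where k: "succ_pos r j k" "k \<in> underS r i" using limit_pos_succ[OF assms j(1)] .
    have "(arc_step E ^^ Suc n) {} \<subseteq> arc_rank E r k"
      unfolding arc_rank_succ_pos[OF assms(1) k(1)] using arc_step_mono[OF j(2)] by simp
    then show ?case using k(2) by blast
  qed
  then show ?thesis using that by blast
qed

text \<open>In a connected graph these are the vertices at distance more than n from
  \<open>w\<close>. The recursion follows a cop step by step and avoids a distance function.\<close>

primrec far :: "'a set \<Rightarrow> ('a \<Rightarrow> 'a \<Rightarrow> bool) \<Rightarrow> 'a \<Rightarrow> nat \<Rightarrow> 'a set" where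
  "far V E w 0 = V - {w}"
| "far V E w (Suc n) = {v \<in> V. cnbhd V E v \<subseteq> far V E w n}"

text \<open>The robber just waits at \<open>w\<close>: each cop move lowers the index of
  \<open>far\<close> by one and leaves the cop away from \<open>w\<close> to the end.\<close>

lemma far_outlasts:
  assumes "\<And>v. v \<in> V - {w} \<Longrightarrow> (w, v) \<notin> X"
  shows "v \<in> far V E w n \<Longrightarrow> (w, v) \<notin> (cop_step V E ^^ n) X"
proof (induction n arbitrary: v)
  case 0
  then show ?case using assms by simp
next
  case (Suc n)
  then have "(w, y) \<notin> (cop_step V E ^^ n) X" if "y \<in> cnbhd V E v" for y
    using that by auto
  then show ?case using self_in_cnbhd[of w V E] by (auto simp: cop_step_iff)
qed

section \<open>Ranks against rounds: upper and lower bounds, and change of root\<close>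

context tree_graph
begin

text \<open>The pairs (robber, cop) from which walking towards the robber is to succeed:
  \<open>X\<close> holds the arc into the cop's vertex on the robber's side.\<close>

definition chase :: "'a rel \<Rightarrow> 'a rel" where
  "chase X = Id_on V \<union> {(u, v). \<exists>w. E w v \<and> (w, v) \<in> X \<and> u \<in> branch E w v}"

text \<open>The cop stays at v if the robber runs into it and otherwise moves to w. It then has
  caught the robber or faces it across a continuation of the arc (w, v), which lies in
  \<open>X\<close>.\<close>

lemma chase_step: "chase (arc_step E X) \<subseteq> cop_step V E (chase X)"
proof (rule subrelI)
  fix u v assume uv: "(u, v) \<in> chase (arc_step E X)"
  show "(u, v) \<in> cop_step V E (chase X)"
  proof (cases "u = v")
    case True
    have "Id_on V \<subseteq> cop_step V E (chase X)" by (rule Id_on_subset_cop_step) (simp add: chase_def)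
    moreover have "(u, v) \<in> Id_on V" using True uv edgeD(2) by (auto simp: chase_def)
    ultimately show ?thesis by blast
  next
    case False
    then obtain w where w: "E w v" "(w, v) \<in> arc_step E X" "u \<in> branch E w v"
      using uv by (auto simp: chase_def)
    have V: "u \<in> V" "v \<in> V" using branch_subset[OF w(3)] edgeD[OF w(1)] by auto
    have "\<exists>y\<in>cnbhd V E v. (x, y) \<in> chase X" if x: "x \<in> cnbhd V E u" for x
    proof -
      have xV: "x \<in> V" using x cnbhd_subset[OF V(1)] by blast
      consider "x = v" | "x = w" | "x \<in> branch E w v" "x \<noteq> w"
        using x branch_neighbour[OF w(1,3), of x] w(3) by (auto simp: cnbhd_iff)
      then show ?thesis
      proof cases
        case 1
        then show ?thesis using xV by (intro bexI[of _ v]) (auto simp: chase_def cnbhd_iff)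
      next
        case 2
        then show ?thesis using xV edgeD(4)[OF w(1)]
          by (intro bexI[of _ w]) (auto simp: chase_def cnbhd_iff)
      next
        case 3
        obtain z where z: "E z w" "z \<noteq> v" "x \<in> branch E z w"
          using branch_cases[OF w(1) 3] .
        have "(z, w) \<in> X" using w(2) z(1,2) by (simp add: arc_step_iff)
        then have "(x, w) \<in> chase X" using z(1,3) by (auto simp: chase_def)
        then show ?thesis using edgeD(4)[OF w(1)] by (intro bexI[of _ w]) (simp_all add: cnbhd_iff)
      qed
    qed
    then show ?thesis using V by (simp add: cop_step_iff)
  qed
qed

lemma chase_funpow: "chase ((arc_step E ^^ n) X) \<subseteq> (cop_step V E ^^ n) (chase X)"
proof (induction n)
  case (Suc n)
  have "chase ((arc_step E ^^ Suc n) X) \<subseteq> cop_step V E (chase ((arc_step E ^^ n) X))"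
    using chase_step by simp
  also have "\<dots> \<subseteq> (cop_step V E ^^ Suc n) (chase X)" using cop_step_mono[OF Suc] by simp
  finally show ?case .
qed simp

text \<open>Ranks strictly below i match the stage at i: a robber on an arc of rank 0 is caught only
  after one round, while stage 0 is equality.\<close>

lemma chase_in_crle:
  assumes "Well_order r"
  shows "chase (\<Union>j\<in>underS r i. arc_rank E r j) \<subseteq> crle V E r i"
  using assms
proof (induction i rule: underS_induct)
  case (less i)
  show ?case
  proof (rule subrelI)
    fix u v assume uv: "(u, v) \<in> chase (\<Union>j\<in>underS r i. arc_rank E r j)"
    show "(u, v) \<in> crle V E r i"
    proof (cases "(u, v) \<in> Id_on V")
      case True
      then show ?thesis using Id_on_subset_crle[OF assms] by blast
    next
      case False
      then obtain j where j: "j \<in> underS r i" "(u, v) \<in> chase (arc_rank E r j)"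
        using uv unfolding chase_def by blast
      have "chase (arc_rank E r j) \<subseteq> cop_step V E (chase (\<Union>k\<in>underS r j. arc_rank E r k))"
        unfolding arc_rank_rec[OF assms, of E j] by (rule chase_step)
      also have "\<dots> \<subseteq> cop_step V E (\<Union>k\<in>underS r i. crle V E r k)"
        using less.IH[OF j(1)] j(1) by (intro cop_step_mono) blast
      also have "\<dots> = crle V E r i"
        by (rule crle_nonmin[OF assms, symmetric]) (use j(1) in blast)
      finally show ?thesis using j(2) by blast
    qed
  qed
qed

lemma chase_arc_rank:
  assumes "Well_order r"
  shows "chase (arc_rank E r i) \<subseteq> cop_step V E (crle V E r i)"
proof -
  have "chase (arc_rank E r i) \<subseteq> cop_step V E (chase (\<Union>j\<in>underS r i. arc_rank E r j))"
    unfolding arc_rank_rec[OF assms, of E i] by (rule chase_step)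
  then show ?thesis using cop_step_mono[OF chase_in_crle[OF assms]] by blast
qed

lemma in_chase:
  assumes "u \<in> V" "v \<in> V" "arcs_into E X v"
  shows "(u, v) \<in> chase X"
proof (cases "u = v")
  case False
  then obtain w where "E w v" "u \<in> branch E w v" using branch_exists[OF assms(1,2)] by blast
  then show ?thesis using assms(3) by (auto simp: chase_def arcs_into_def)
qed (use assms in \<open>auto simp: chase_def\<close>)

text \<open>The robber at x runs on, never back to w. By \<open>arc_shift\<close> the cop remains
  outside the branch ahead, wherever it started behind, so each cop reply at a smaller stage bounds
  the rank of the next arc.\<close>

lemma crle_imp_arc_rank:
  assumes "Well_order r" "E x w" "y \<notin> branch E x w" "(x, y) \<in> crle V E r i"
  shows "(x, w) \<in> arc_rank E r i"
  using assms
proof (induction i arbitrary: x w y rule: underS_induct)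
  case (less i)
  have "x \<noteq> y" using less.prems(2) branch_root[of x E w] by blast
  then have ne: "underS r i \<noteq> {}" using less.prems(3) crle_min[OF assms(1), of i V E] by auto
  have step: "\<forall>z\<in>cnbhd V E x. \<exists>y'\<in>cnbhd V E y. (z, y') \<in> (\<Union>j\<in>underS r i. crle V E r j)"
    using less.prems(3) unfolding crle_nonmin[OF assms(1) ne] by (simp add: cop_step_iff)
  have "(z, x) \<in> (\<Union>j\<in>underS r i. arc_rank E r j)" if z: "E z x" "z \<noteq> w" for z
  proof -
    obtain y' j where "y' \<in> cnbhd V E y" "j \<in> underS r i" "(z, y') \<in> crle V E r j"
      using step edgeD(4)[OF z(1)] by (fastforce simp: cnbhd_iff)
    then show ?thesis
      using less.IH[of j z x y'] arc_shift[OF z(1) less.prems(1) z(2) less.prems(2)] z(1) by blast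
  qed
  then show ?case
    unfolding arc_rank_rec[OF assms(1), of E i] using less.prems(1) by (simp add: arc_step_iff)
qed

text \<open>The arcs into v' not coming from v continue the arc (v', v), which points into v. The
  arc (v, v') is continued by arcs into v. So moving the root along an edge costs one application of
  \<open>arc_step\<close>.\<close>

lemma arcs_into_step:
  assumes "X \<subseteq> arc_step E X" "arcs_into E X v" "E v v'"
  shows "arcs_into E (arc_step E X) v'"
  unfolding arcs_into_def
proof (intro allI impI)
  fix x assume x: "E x v'"
  show "(x, v') \<in> arc_step E X"
  proof (cases "x = v")
    case True
    then show ?thesis using assms(2,3) by (auto simp: arc_step_iff arcs_into_def)
  next
    case False
    have "(v', v) \<in> arc_step E X"
      using assms edgeD(4)[OF assms(3)] by (auto simp: arcs_into_def)
    then have "(x, v') \<in> X" using x False by (simp add: arc_step_iff)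
    then show ?thesis using assms(1) by blast
  qed
qed

lemma arcs_into_reroot:
  assumes "X \<subseteq> arc_step E X" "arcs_into E X v" "v \<in> V" "v' \<in> V"
  obtains n where "arcs_into E ((arc_step E ^^ n) X) v'"
proof -
  have "\<exists>n. arcs_into E ((arc_step E ^^ n) X) v'"
  proof (rule connected_induct[OF assms(3,4)])
    show "\<exists>n. arcs_into E ((arc_step E ^^ n) X) v"
      using assms(2) by (intro exI[of _ 0]) simp
    fix x y assume "\<exists>n. arcs_into E ((arc_step E ^^ n) X) x" "E x y"
    then obtain n where "arcs_into E ((arc_step E ^^ n) X) x" by blast
    then have "arcs_into E ((arc_step E ^^ Suc n) X) y"
      using arcs_into_step[OF arc_step_funpow_closed[OF assms(1)] _ \<open>E x y\<close>] by simp
    then show "\<exists>n. arcs_into E ((arc_step E ^^ n) X) y" by blast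
  qed
  then show ?thesis using that by blast
qed

text \<open>A branch of rank below n has depth below n, so one number of steps serves for re-rooting
  at any of its vertices. The induction is on the rank bound, with \<open>X\<close> absorbing the
  steps already made.\<close>

lemma arcs_into_branch:
  assumes "(u, v) \<in> (arc_step E ^^ n) {}" "X \<subseteq> arc_step E X" "arcs_into E X u" "x \<in> branch E u v"
  shows "arcs_into E ((arc_step E ^^ n) X) x"
  using assms
proof (induction n arbitrary: u v X)
  case (Suc n)
  have uv: "(u, v) \<in> arc_step E ((arc_step E ^^ n) {})" using Suc.prems(1) by simp
  show ?case
  proof (cases "x = u")
    case True
    then show ?thesis
      using arcs_into_mono[OF Suc.prems(3)] arc_step_funpow_le[OF Suc.prems(2), of 0 "Suc n"] by simp
  next
    case False
    obtain w where w: "E w u" "w \<noteq> v" "x \<in> branch E w u"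
      using branch_cases[OF arc_step_edge[OF uv] Suc.prems(4) False] .
    have "(w, u) \<in> (arc_step E ^^ n) {}" using uv w(1,2) by (simp add: arc_step_iff)
    moreover have "arcs_into E (arc_step E X) w"
      using arcs_into_step[OF Suc.prems(2,3) edgeD(4)[OF w(1)]] .
    ultimately show ?thesis
      using Suc.IH[OF _ arc_step_mono[OF Suc.prems(2)] _ w(3)] by (simp add: funpow_swap1)
  qed
qed simp

text \<open>Fix an edge v w. All arcs into v except (w, v) continue (v, w), so two finite ranks
  bound the tree rooted at v. This also bounds its depth, and with it the cost of moving the root
  anywhere.\<close>

lemma finite_arc_ranks_bounded:
  assumes "\<And>u v. E u v \<Longrightarrow> \<exists>n. (u, v) \<in> (arc_step E ^^ n) {}"
  obtains N where "\<And>v. v \<in> V \<Longrightarrow> arcs_into E ((arc_step E ^^ N) {}) v"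
proof -
  obtain v where v: "v \<in> V" using tree by (auto simp: tree_def)
  obtain M where M: "arcs_into E ((arc_step E ^^ M) {}) v"
  proof (cases "\<exists>w. E v w")
    case True
    then obtain w where w: "E v w" by blast
    obtain m n where mn: "(v, w) \<in> (arc_step E ^^ m) {}" "(w, v) \<in> (arc_step E ^^ n) {}"
      using assms[OF w] assms[OF edgeD(4)[OF w]] by blast
    have "(x, v) \<in> (arc_step E ^^ max m n) {}" if x: "E x v" for x
    proof (cases "x = w")
      case True
      then show ?thesis using mn(2) arc_step_funpow_le[of "{}" E n "max m n"] by auto
    next
      case False
      have "(v, w) \<in> arc_step E ((arc_step E ^^ m) {})"
        using mn(1) arc_step_funpow_closed[of "{}" E m] by blast
      then have "(x, v) \<in> (arc_step E ^^ m) {}" using x False by (simp add: arc_step_iff)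
      then show ?thesis using arc_step_funpow_le[of "{}" E m "max m n"] by auto
    qed
    then have "arcs_into E ((arc_step E ^^ max m n) {}) v" by (simp add: arcs_into_def)
    then show ?thesis by (rule that)
  next
    case False
    then show ?thesis using that[of 0] edgeD(4) by (auto simp: arcs_into_def)
  qed
  let ?X = "(arc_step E ^^ M) {}"
  have closed: "?X \<subseteq> arc_step E ?X" by (rule arc_step_funpow_closed) simp
  show ?thesis
  \<comment> \<open>M bounds the ranks at v, one step moves the root to a neighbour u, and M more
    steps reach any vertex of the branch of u.\<close>
  proof (rule that[of "M + Suc M"])
    fix x assume x: "x \<in> V"
    have X: "(arc_step E ^^ (M + Suc M)) {} = (arc_step E ^^ M) (arc_step E ?X)"
      by (simp add: funpow_add funpow_swap1)
    show "arcs_into E ((arc_step E ^^ (M + Suc M)) {}) x"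
    proof (cases "x = v")
      case True
      then show ?thesis
        using arcs_into_mono[OF M] arc_step_funpow_le[of "{}" E M "M + Suc M"] by simp
    next
      case False
      obtain u where u: "E u v" "x \<in> branch E u v" using branch_exists[OF x v False] .
      have "(u, v) \<in> ?X" using M u(1) by (simp add: arcs_into_def)
      moreover have "arcs_into E (arc_step E ?X) u"
        by (rule arcs_into_step[OF closed M edgeD(4)[OF u(1)]])
      ultimately show ?thesis
        unfolding X using arcs_into_branch[OF _ arc_step_mono[OF closed] _ u(2)] by blast
    qed
  qed
qed

text \<open>Passing to a continuation of large rank gives up one unit of rank and gains one unit of
  distance for the whole branch.\<close>

lemma far_nonempty:
  assumes "E u v" "(u, v) \<notin> (arc_step E ^^ n) {}" "branch E u v \<subseteq> far V E w m"
  shows "far V E w (m + n) \<noteq> {}"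
  using assms
proof (induction n arbitrary: u v m)
  case 0
  then show ?case using branch_root[of u E v] by auto
next
  case (Suc n)
  then obtain x where x: "E x u" "x \<noteq> v" "(x, u) \<notin> (arc_step E ^^ n) {}"
    by (auto simp: arc_step_iff)
  have "branch E x u \<subseteq> far V E w (Suc m)"
  proof
    fix y assume y: "y \<in> branch E x u"
    have "cnbhd V E y \<subseteq> branch E u v"
    proof
      fix z assume "z \<in> cnbhd V E y"
      then have "z = u \<or> z \<in> branch E x u"
        using y branch_neighbour[OF x(1) y] by (auto simp: cnbhd_iff)
      then show "z \<in> branch E u v"
        using branch_subset_branch[OF x(1) Suc.prems(1) x(2)] branch_root[of u E v] by blast
    qed
    moreover have "y \<in> V" using branch_subset[OF y] edgeD(1)[OF x(1)] .
    ultimately show "y \<in> far V E w (Suc m)" using Suc.prems(3) by auto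
  qed
  then show ?case using Suc.IH[OF x(1,3)] by fastforce
qed

text \<open>A robber at w escapes into a branch of large rank as soon as the cop arrives; waiting at w
  while a cop from far away approaches adds any finite number of further steps.\<close>

lemma limit_vertex_lower_bound:
  assumes r: "Well_order r" "limit_pos r i" and w: "w \<in> V" and C: "\<And>x. x \<in> C \<Longrightarrow> E x w"
    and below: "\<And>x. x \<in> C \<Longrightarrow> \<exists>j\<in>underS r i. (x, w) \<in> arc_rank E r j"
    and cofinal: "\<And>j. j \<in> underS r i \<Longrightarrow> \<exists>x\<in>C. (x, w) \<notin> arc_rank E r j"
  shows "(cop_step V E ^^ n) (crle V E r i) \<noteq> V \<times> V"
proof -
  have ne: "underS r i \<noteq> {}" using r(2) by (simp add: limit_pos_def)
  have escape: "(w, v) \<notin> (\<Union>j\<in>underS r i. crle V E r j)" if v: "v \<in> V - {w}" for v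
  proof
    assume "(w, v) \<in> (\<Union>j\<in>underS r i. crle V E r j)"
    then obtain j where j: "j \<in> underS r i" "(w, v) \<in> crle V E r j" by blast
    obtain x0 where x0: "E x0 w" "v \<in> branch E x0 w" using branch_exists v w by blast
    \<comment> \<open>The cop sits in the branch of x0. With k above j and, if x0 is in C, above the
      rank of that branch, a neighbour in C of rank beyond k opens a branch without the cop.\<close>
    have "\<exists>k\<in>underS r i. (j, k) \<in> r \<and> (x0 \<in> C \<longrightarrow> (x0, w) \<in> arc_rank E r k)"
    proof (cases "x0 \<in> C")
      case True
      then obtain l where l: "l \<in> underS r i" "(x0, w) \<in> arc_rank E r l" using below by blast
      have "j \<in> Field r" "l \<in> Field r" using j(1) l(1) by (auto simp: underS_def Field_def)
      then consider "(j, l) \<in> r" | "(l, j) \<in> r" "(j, j) \<in> r"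
        using Well_order_total[OF r(1), of j l] Well_order_refl[OF r(1)] by (auto simp: underS_def)
      then show ?thesis
        using j(1) l arc_rank_mono[OF r(1), of l j E] by cases blast+
    next
      case False
      have "j \<in> Field r" using j(1) by (auto simp: underS_def Field_def)
      then show ?thesis using False j(1) Well_order_refl[OF r(1)] by blast
    qed
    then obtain k where k: "k \<in> underS r i" "(j, k) \<in> r" "x0 \<in> C \<longrightarrow> (x0, w) \<in> arc_rank E r k"
      by blast
    obtain x where x: "x \<in> C" "(x, w) \<notin> arc_rank E r k" using cofinal[OF k(1)] by blast
    have "x \<noteq> x0" using x k(3) by blast
    then have vx: "v \<notin> branch E x w" using branches_disjoint[OF C[OF x(1)] x0(1)] x0(2) by blast
    have nej: "underS r j \<noteq> {}"
    proof
      assume "underS r j = {}"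
      then show False using j(2) v by (auto simp: crle_min[OF r(1)])
    qed
    have "x \<in> cnbhd V E w" using edgeD(4)[OF C[OF x(1)]] by (simp add: cnbhd_iff)
    then obtain y m where y: "y \<in> cnbhd V E v" "m \<in> underS r j" "(x, y) \<in> crle V E r m"
      using j(2) unfolding crle_nonmin[OF r(1) nej] cop_step_def by blast
    have "y \<notin> branch E x w"
    proof
      assume yx: "y \<in> branch E x w"
      then have "E y v" using y(1) vx edgeD(4) by (auto simp: cnbhd_iff)
      then show False using branch_neighbour[OF C[OF x(1)] yx] vx v by blast
    qed
    then have "(x, w) \<in> arc_rank E r m" using crle_imp_arc_rank[OF r(1) C[OF x(1)] _ y(3)] by blast
    moreover have "(m, k) \<in> r"
      using y(2) k(2) underS_trans[OF r(1) y(2) k(2)] by (simp add: underS_def)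
    ultimately show False using arc_rank_mono[OF r(1)] x(2) by blast
  qed
  \<comment> \<open>One step more than n is needed because the stage at i is itself one
    \<open>cop_step\<close> beyond the union of the stages below it.\<close>
  obtain j where j: "j \<in> underS r i" "(arc_step E ^^ Suc n) {} \<subseteq> arc_rank E r j"
    using arc_rank_finite_pos[OF r] .
  obtain x where x: "x \<in> C" "(x, w) \<notin> arc_rank E r j" using cofinal[OF j(1)] by blast
  have "branch E x w \<subseteq> far V E w 0"
    using branch_subset[of _ x w] edgeD(1)[OF C[OF x(1)]] apex_notin_branch[OF C[OF x(1)]] by auto
  then have "far V E w (0 + Suc n) \<noteq> {}"
    using far_nonempty[OF C[OF x(1)], of "Suc n"] x(2) j(2) by blast
  then obtain v where v: "v \<in> far V E w (Suc n)" by auto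
  then have "v \<in> V" by simp
  have "(w, v) \<notin> (cop_step V E ^^ Suc n) (\<Union>j\<in>underS r i. crle V E r j)"
    by (rule far_outlasts[OF escape v])
  then have "(w, v) \<notin> (cop_step V E ^^ n) (crle V E r i)"
    unfolding crle_nonmin[OF r(1) ne] by (simp add: funpow_swap1)
  then show ?thesis using w \<open>v \<in> V\<close> by blast
qed

text \<open>The chase needs as many extra rounds as the rank of the arc towards u exceeds i, plus
  one. The number depends on the pair, so only the union of all iterates is shown to be
  total.\<close>

lemma limit_vertex_upper_bound:
  assumes r: "Well_order r" and arcs: "\<And>u v. E u v \<Longrightarrow> \<exists>n. (u, v) \<in> (arc_step E ^^ n) (arc_rank E r i)"
    and "u \<in> V" "v \<in> V"
  obtains n where "(u, v) \<in> (cop_step V E ^^ n) (crle V E r i)"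
proof (cases "u = v")
  case True
  then have "(u, v) \<in> (cop_step V E ^^ 0) (crle V E r i)"
    using Id_on_subset_crle[OF r, of V E i] assms(3) by auto
  then show ?thesis by (rule that)
next
  case False
  obtain w where w: "E w v" "u \<in> branch E w v" using branch_exists[OF assms(3,4) False] .
  obtain n where "(w, v) \<in> (arc_step E ^^ n) (arc_rank E r i)" using arcs[OF w(1)] by blast
  then have "(u, v) \<in> chase ((arc_step E ^^ n) (arc_rank E r i))"
    using w by (auto simp: chase_def)
  then have "(u, v) \<in> (cop_step V E ^^ n) (cop_step V E (crle V E r i))"
    using chase_funpow cop_step_funpow_mono[OF chase_arc_rank[OF r]] by blast
  then have "(u, v) \<in> (cop_step V E ^^ Suc n) (crle V E r i)" by (simp add: funpow_swap1)
  then show ?thesis by (rule that)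
qed

lemma rank_dichotomy:
  assumes r: "Well_order r" and wf: "wf (next_arc E)"
    and top: "\<And>u v. E u v \<Longrightarrow> (u, v) \<in> arc_rank E r t"
  obtains N where "(cop_step V E ^^ N) (Id_on V) = V \<times> V"
  | i where "limit_pos r i" "\<And>n. (cop_step V E ^^ n) (crle V E r i) \<noteq> V \<times> V"
      "\<And>u v. u \<in> V \<Longrightarrow> v \<in> V \<Longrightarrow> \<exists>n. (u, v) \<in> (cop_step V E ^^ n) (crle V E r i)"
proof -
  define full where "full i \<longleftrightarrow> (\<forall>u v. E u v \<longrightarrow> (\<exists>n. (u, v) \<in> (arc_step E ^^ n) (arc_rank E r i)))" for i
  have "full t" unfolding full_def using top by (metis funpow_0)
  then obtain i where i: "full i" and least: "\<And>k. k \<in> underS r i \<Longrightarrow> \<not> full k"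
    using least_pos[OF r, of full t] by blast
  from r show ?thesis
  proof (cases rule: pos_cases[where i = i])
    case 1
    then have rank: "arc_rank E r i = arc_step E {}" using arc_rank_rec[OF r, of E i] by simp
    have "\<exists>n. (u, v) \<in> (arc_step E ^^ n) {}" if uv: "E u v" for u v
    proof -
      obtain n where "(u, v) \<in> (arc_step E ^^ n) (arc_step E {})"
        using i uv unfolding full_def rank by blast
      then have "(u, v) \<in> (arc_step E ^^ Suc n) {}" by (simp add: funpow_swap1)
      then show ?thesis by blast
    qed
    then obtain N where N: "\<And>v. v \<in> V \<Longrightarrow> arcs_into E ((arc_step E ^^ N) {}) v"
      using finite_arc_ranks_bounded by blast
    have "V \<times> V \<subseteq> chase ((arc_step E ^^ N) {})" using in_chase[OF _ _ N] by blast
    also have "\<dots> \<subseteq> (cop_step V E ^^ N) (chase {})" by (rule chase_funpow)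
    also have "chase {} = Id_on V" by (simp add: chase_def)
    finally have "V \<times> V \<subseteq> (cop_step V E ^^ N) (Id_on V)" .
    moreover have "(cop_step V E ^^ N) (Id_on V) \<subseteq> V \<times> V"
      by (cases N) (auto simp: cop_step_iff)
    ultimately show ?thesis using that(1) by blast
  next
    case (2 j)
    have "full j"
      unfolding full_def
    proof (intro allI impI)
      fix u v assume "E u v"
      then obtain n where "(u, v) \<in> (arc_step E ^^ n) (arc_rank E r i)"
        using i unfolding full_def by blast
      then have "(u, v) \<in> (arc_step E ^^ Suc n) (arc_rank E r j)"
        unfolding arc_rank_succ_pos[OF r 2] by (simp add: funpow_swap1)
      then show "\<exists>n. (u, v) \<in> (arc_step E ^^ n) (arc_rank E r j)" by blast
    qed
    then show ?thesis using least[of j] underS_succ_pos[OF r 2] by blast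
  next
    case 3
    let ?G = "\<Union>j\<in>underS r i. arc_rank E r j"
    \<comment> \<open>If some arc has no rank below i, a minimal such arc (w, v) works, with C the
      neighbours of w except v: were their ranks bounded below the limit i, the rank of (w, v) would
      be below i too. If all ranks are below i, any w works: a bound j on the arcs into w would make
      j full by re-rooting.\<close>
    have "\<exists>w C. w \<in> V \<and> (\<forall>x\<in>C. E x w) \<and> (\<forall>x\<in>C. \<exists>j\<in>underS r i. (x, w) \<in> arc_rank E r j) \<and>
        (\<forall>j\<in>underS r i. \<exists>x\<in>C. (x, w) \<notin> arc_rank E r j)"
    proof (cases "\<exists>u v. E u v \<and> (u, v) \<notin> ?G")
      case True
      then obtain p where p: "p \<in> {(u, v). E u v \<and> (u, v) \<notin> ?G}" by blast
      obtain q where q: "q \<in> {(u, v). E u v \<and> (u, v) \<notin> ?G}"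
        and qmin: "\<And>p. (p, q) \<in> next_arc E \<Longrightarrow> p \<notin> {(u, v). E u v \<and> (u, v) \<notin> ?G}"
        using wfE_min[OF wf p] by blast
      obtain w v where wv: "q = (w, v)" by fastforce
      have E: "E w v" and nG: "(w, v) \<notin> ?G" using q wv by auto
      have child: "(x, w) \<in> ?G" if "E x w" "x \<noteq> v" for x
      proof -
        have "((x, w), q) \<in> next_arc E" using that E wv by (auto simp: next_arc_def)
        then show ?thesis using qmin that(1) by blast
      qed
      have "\<exists>x\<in>{x. E x w \<and> x \<noteq> v}. (x, w) \<notin> arc_rank E r j" if j: "j \<in> underS r i" for j
      proof (rule ccontr)
        assume "\<not> ?thesis"
        then have "(w, v) \<in> arc_step E (arc_rank E r j)" using E by (auto simp: arc_step_iff)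
        moreover obtain k where k: "succ_pos r j k" "k \<in> underS r i"
          using limit_pos_succ[OF r 3 j] .
        ultimately show False using nG arc_rank_succ_pos[OF r k(1), of E] by blast
      qed
      then show ?thesis
        using child edgeD(1)[OF E] by (intro exI[of _ w] exI[of _ "{x. E x w \<and> x \<noteq> v}"]) auto
    next
      case False
      obtain w where w: "w \<in> V" using tree by (auto simp: tree_def)
      have "\<exists>x\<in>{x. E x w}. (x, w) \<notin> arc_rank E r j" if j: "j \<in> underS r i" for j
      proof (rule ccontr)
        assume "\<not> ?thesis"
        then have into: "arcs_into E (arc_rank E r j) w" by (simp add: arcs_into_def)
        have "full j"
          unfolding full_def
        proof (intro allI impI)
          fix u v assume uv: "E u v"
          obtain n where "arcs_into E ((arc_step E ^^ n) (arc_rank E r j)) v"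
            using arcs_into_reroot[OF arc_rank_closed[OF r] into w edgeD(2)[OF uv]] .
          then show "\<exists>n. (u, v) \<in> (arc_step E ^^ n) (arc_rank E r j)"
            using uv by (auto simp: arcs_into_def)
        qed
        then show False using least[OF j] by blast
      qed
      then show ?thesis using w False by (intro exI[of _ w] exI[of _ "{x. E x w}"]) auto
    qed
    then obtain w C where wC: "w \<in> V" "\<And>x. x \<in> C \<Longrightarrow> E x w"
      "\<And>x. x \<in> C \<Longrightarrow> \<exists>j\<in>underS r i. (x, w) \<in> arc_rank E r j"
      "\<And>j. j \<in> underS r i \<Longrightarrow> \<exists>x\<in>C. (x, w) \<notin> arc_rank E r j" by blast
    show ?thesis
    proof (rule that(2)[OF 3])
      show "(cop_step V E ^^ n) (crle V E r i) \<noteq> V \<times> V" for n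
        by (rule limit_vertex_lower_bound[OF r 3 wC])
      show "\<exists>n. (u, v) \<in> (cop_step V E ^^ n) (crle V E r i)" if "u \<in> V" "v \<in> V" for u v
      proof (rule limit_vertex_upper_bound[OF r _ that])
        show "\<exists>n. (x, y) \<in> (arc_step E ^^ n) (arc_rank E r i)" if "E x y" for x y
          using i that by (simp add: full_def)
      qed blast
    qed
  qed
qed

text \<open>Well-founded induction on arcs: when the relation covers the branches of all
  continuations of (w, v), one chase step covers the branch of w, and stability absorbs that
  step.\<close>

lemma stable_imp_total:
  assumes r: "Well_order r" and wf: "wf (next_arc E)"
    and stable: "cop_step V E (crle V E r t) = crle V E r t"
  shows "crle V E r t = V \<times> V"
proof -
  let ?L = "crle V E r t"
  have arc: "u \<in> branch E (fst a) (snd a) \<Longrightarrow> E (fst a) (snd a) \<Longrightarrow> (u, snd a) \<in> ?L" for a u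
    using wf
  proof (induction a arbitrary: u rule: wf_induct_rule)
    case (less a)
    obtain w v where a: "a = (w, v)" by fastforce
    define X where "X = {(x, w) | x. E x w \<and> x \<noteq> v}"
    have "chase X \<subseteq> ?L"
    proof (rule subrelI)
      fix x y assume xy: "(x, y) \<in> chase X"
      show "(x, y) \<in> ?L"
      proof (cases "(x, y) \<in> Id_on V")
        case True
        then show ?thesis using Id_on_subset_crle[OF r] by blast
      next
        case False
        then obtain z where z: "E z w" "z \<noteq> v" "x \<in> branch E z w" "y = w"
          using xy by (auto simp: chase_def X_def)
        then have "((z, w), a) \<in> next_arc E" using less.prems a by (auto simp: next_arc_def)
        then show ?thesis using less.IH[of "(z, w)" x] z by simp
      qed
    qed
    moreover have "(u, v) \<in> chase (arc_step E X)"
      using less.prems a by (auto simp: chase_def arc_step_iff X_def)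
    ultimately show ?case
      using chase_step[of X] cop_step_mono[of "chase X" ?L V E] stable a by auto
  qed
  have "(u, v) \<in> ?L" if uv: "u \<in> V" "v \<in> V" for u v
  proof (cases "u = v")
    case True
    then show ?thesis using Id_on_subset_crle[OF r, of V E t] uv by auto
  next
    case False
    obtain w where "E w v" "u \<in> branch E w v" using branch_exists[OF uv False] .
    then show ?thesis using arc[of u "(w, v)"] by simp
  qed
  then show ?thesis using crle_subset[OF r, of V E t] by blast
qed

end

section \<open>The CR-ordinal of a cop-win tree\<close>

lemma finite_pos_exists:
  assumes "Well_order s" "infinite (Field s)"
  obtains j where "j \<in> Field s" "finite (underS s j)" "card (underS s j) = n"
proof -
  have "\<exists>j\<in>Field s. finite (underS s j) \<and> card (underS s j) = n"
  proof (induction n)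
    case 0
    obtain i where "i \<in> Field s" using infinite_imp_nonempty[OF assms(2)] by blast
    then obtain j where j: "j \<in> Field s" "\<And>k. k \<in> underS s j \<Longrightarrow> k \<notin> Field s"
      using least_pos[OF assms(1), of "\<lambda>j. j \<in> Field s" i] by blast
    have "underS s j = {}" using j(2) by (auto simp: underS_def Field_def)
    then show ?case using j(1) by (intro bexI[of _ j]) simp_all
  next
    case (Suc n)
    then obtain j where j: "j \<in> Field s" "finite (underS s j)" "card (underS s j) = n" by blast
    have "\<not> Field s \<subseteq> insert j (underS s j)" using assms(2) j(2) by (meson finite_insert finite_subset)
    then obtain m where m: "m \<in> Field s" "m \<noteq> j" "m \<notin> underS s j" by blast
    then have "j \<in> underS s m" using Well_order_total[OF assms(1) j(1) m(1)] by (auto simp: underS_def)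
    then obtain k where k: "succ_pos s j k" using succ_pos_exists[OF assms(1)] by blast
    have "j \<notin> underS s j" by (simp add: underS_def)
    then have "finite (underS s k)" "card (underS s k) = Suc n"
      using underS_succ_pos[OF assms(1) k] j by auto
    moreover have "k \<in> Field s" using k by (auto simp: succ_pos_def Field_def)
    ultimately show ?case by blast
  qed
  then show ?thesis using that by blast
qed

lemma succ_pos_plus_two_Inl:
  assumes "succ_pos (plus_two s) (Inl j) (Inl k)"
  shows "succ_pos s j k"
  unfolding succ_pos_def
proof (intro conjI allI impI)
  show "(j, k) \<in> s - Id" using assms by (simp add: plus_two_eq_osum succ_pos_def)
  fix m assume "(j, m) \<in> s - Id"
  then have "(Inl j, Inl m) \<in> plus_two s - Id" by (simp add: plus_two_eq_osum)
  then have "(Inl k, Inl m) \<in> plus_two s" using assms unfolding succ_pos_def by blast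
  then show "(k, m) \<in> s" by (simp add: plus_two_eq_osum)
qed

text \<open>The isomorphism is the identity below i and p on the copy of the natural
  numbers.\<close>

lemma ordIso_plus_omega:
  assumes s: "Well_order s" and i: "i \<in> Field s" and p0: "p 0 = i"
    and p: "\<And>n. succ_pos s (p n) (p (Suc n))"
    and cover: "\<And>x. x \<in> Field s \<Longrightarrow> x \<in> underS s i \<or> (\<exists>n. x = p n)"
  shows "(s, plus_omega (Restr s (underS s i))) \<in> ordIso"
proof -
  let ?a = "Restr s (underS s i)"
  have Fa: "Field ?a = underS s i"
  proof (rule Refl_Field_Restr2)
    show "Refl s" using s by (simp add: order_on_defs)
    show "underS s i \<subseteq> Field s" by (auto simp: underS_def Field_def)
  qed
  have pF: "p n \<in> Field s" for n using p[of n] by (auto simp: succ_pos_def Field_def)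
  have less: "p m \<in> underS s (p n)" if "m < n" for m n
    using that
  proof (induction rule: strict_inc_induct)
    case (base m)
    then show ?case using p[of m] by (auto simp: succ_pos_def underS_def)
  next
    case (step m)
    have "(p m, p (Suc m)) \<in> s" using p[of m] by (simp add: succ_pos_def)
    then show ?case using underS_trans'[OF s _ step.IH] by blast
  qed
  have le: "(p m, p n) \<in> s \<longleftrightarrow> m \<le> n" for m n
  proof
    show "m \<le> n" if "(p m, p n) \<in> s"
      using that less[of n m] Well_order_antisym[OF s, of "p m" "p n"]
      by (cases "m \<le> n") (auto simp: underS_def)
    show "(p m, p n) \<in> s" if "m \<le> n"
      using that less[of m n] Well_order_refl[OF s pF] by (cases "m = n") (auto simp: underS_def)
  qed
  have ip: "(i, p n) \<in> s" for n using le[of 0 n] p0 by simp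
  let ?g = "case_sum id p"
  have below: "x \<in> underS s (p n)" if "x \<in> underS s i" for x n
    using underS_trans[OF s that ip] .
  have "bij_betw ?g (Field (plus_omega ?a)) (Field s)"
    unfolding bij_betw_def
  proof
    have "p m = p n \<longleftrightarrow> m = n" for m n
      using le[of m n] le[of n m] Well_order_refl[OF s pF, of m] by (metis le_antisym)
    moreover have "p n \<notin> underS s i" for n
      using below[of "p n" n] by (auto simp: underS_def)
    ultimately show "inj_on ?g (Field (plus_omega ?a))"
      unfolding Field_plus_omega Fa by (auto simp: inj_on_def)
    have "?g ` Field (plus_omega ?a) = underS s i \<union> range p"
      unfolding Field_plus_omega Fa image_Un image_image by simp
    moreover have "underS s i \<union> range p \<subseteq> Field s"
      using pF by (auto simp: underS_def Field_def)
    ultimately show "?g ` Field (plus_omega ?a) = Field s" using cover by blast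
  qed
  moreover have "(x, y) \<in> plus_omega ?a \<longleftrightarrow> (?g x, ?g y) \<in> s"
    if "x \<in> Field (plus_omega ?a)" "y \<in> Field (plus_omega ?a)" for x y
  proof (cases x; cases y)
    fix x' y' assume [simp]: "x = Inl x'" "y = Inl y'"
    show ?thesis using that unfolding Field_plus_omega Fa
      by (auto simp: plus_omega_eq_osum)
  next
    fix x' n assume [simp]: "x = Inl x'" "y = Inr n"
    have "x' \<in> underS s i" using that(1) unfolding Field_plus_omega Fa by auto
    then show ?thesis using below[of x' n] Fa
      by (auto simp: plus_omega_eq_osum underS_def Field_le)
  next
    fix n y' assume [simp]: "x = Inr n" "y = Inl y'"
    have "y' \<in> underS s i" using that(2) unfolding Field_plus_omega Fa by auto
    then have "(p n, y') \<notin> s"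
      using below[of y' n] Well_order_antisym[OF s, of y' "p n"] by (auto simp: underS_def)
    then show ?thesis by (simp add: plus_omega_eq_osum)
  next
    fix m n assume [simp]: "x = Inr m" "y = Inr n"
    show ?thesis using le[of m n] by (simp add: plus_omega_eq_osum)
  qed
  ultimately have "iso (plus_omega ?a) s ?g" unfolding iso_iff2 by blast
  moreover have "Well_order (plus_omega ?a)"
    by (rule Well_order_plus_omega[OF Well_order_Restr[OF s]])
  ultimately have "(plus_omega ?a, s) \<in> ordIso" using s by (auto simp: ordIso_def)
  then show ?thesis by (rule ordIso_symmetric)
qed

lemma CR_ordinal_in_Lambda:
  fixes s :: "'b rel"
  assumes "tree V E" "cop_win V E" "is_CR_ordinal V E s"
  shows "in_Lambda s"
proof -
  interpret tree_graph V E by standard (rule assms(1))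
  let ?r = "plus_two s" and ?L = "crle V E (plus_two s)"
  note s = is_CR_ordinalD(1)[OF assms(3)]
  note nontotal = is_CR_ordinalD(3)[OF assms(3)]
  note r = Well_order_plus_two[OF s]
  note wf = cop_win_imp_wf_next_arc[OF assms(2)]
  have top: "?L (Inr False) = V \<times> V"
    by (rule stable_imp_total[OF r wf is_CR_ordinalD(2)[OF assms(3)]])
  \<comment> \<open>Totality at the end bounds every rank, so \<open>plus_two s\<close> is long
    enough to measure them all.\<close>
  have arcs: "(u, v) \<in> arc_rank E ?r (Inr False)" if "E u v" for u v
    by (rule crle_imp_arc_rank[OF r that apex_notin_branch[OF that]])
      (use edgeD[OF that] in \<open>simp add: top\<close>)
  show ?thesis
  proof (rule rank_dichotomy[OF r wf, where t = "Inr False"], goal_cases)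
    case (1 u v)
    then show ?case by (rule arcs)
  next
    case (2 N)
    have "finite (Field s)"
    proof (rule ccontr)
      assume "infinite (Field s)"
      then obtain j where j: "j \<in> Field s" "finite (underS s j)" "card (underS s j) = N"
        using finite_pos_exists[OF s] by blast
      have "?L (Inl j) = V \<times> V"
        using crle_finite_pos[OF r, of "Inl j" V E] j(2,3) 2 by (simp add: card_image)
      then show False using nontotal[OF j(1)] by blast
    qed
    then show ?thesis by (simp add: in_Lambda_def)
  next
    case (3 i)
    \<comment> \<open>A priori the limit position could be one of the two added points; both carry
      the total relation, the limit position does not.\<close>
    have "?L (Inr True) = V \<times> V"
      using crle_succ_pos[OF r succ_pos_plus_two_top, of V E] top cop_step_Times[of V E] by simp
    moreover have "?L i \<noteq> V \<times> V" using 3(2)[of 0] by simp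
    moreover have "i \<in> Field ?r" using 3(1) by (auto simp: limit_pos_def underS_def Field_def)
    ultimately obtain i0 where i0: "i = Inl i0" "i0 \<in> Field s"
      using top unfolding Field_plus_two by (metis (full_types) UnE imageE)
    \<comment> \<open>The last conjunct pins the start to \<open>i0\<close>, since the choice
      principle promises nothing about p 0 beyond P. The successors never leave \<open>s\<close>
      because no iterate is total.\<close>
    define P where "P n x \<longleftrightarrow> x \<in> Field s \<and> ?L (Inl x) = (cop_step V E ^^ n) (?L i) \<and> (n = 0 \<longrightarrow> x = i0)"
      for n x
    have "\<exists>p. \<forall>n. P n (p n) \<and> succ_pos s (p n) (p (Suc n))"
    proof (rule dependent_nat_choice)
      show "\<exists>x. P 0 x" using i0 by (auto simp: P_def)
      fix x n assume x: "P n x"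
      then have "Inl x \<in> underS ?r (Inr False)" by (simp add: P_def)
      then obtain k where k: "succ_pos ?r (Inl x) k" "(k, Inr False) \<in> ?r"
        using succ_pos_exists[OF r] by blast
      have Lk: "?L k = (cop_step V E ^^ Suc n) (?L i)"
        using crle_succ_pos[OF r k(1), of V E] x by (simp add: P_def)
      then have "k \<noteq> Inr False" using 3(2)[of "Suc n"] top by metis
      then obtain y where y: "k = Inl y" "y \<in> Field s" using k(2) by (auto simp: plus_two_def)
      have "P (Suc n) y" using y Lk by (simp add: P_def)
      moreover have "succ_pos s x y" using k(1) succ_pos_plus_two_Inl[of s x y] y(1) by simp
      ultimately show "\<exists>y. P (Suc n) y \<and> succ_pos s x y" by blast
    qed
    then obtain p where p: "\<And>n. P n (p n)" "\<And>n. succ_pos s (p n) (p (Suc n))" by blast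
    have p0: "p 0 = i0" using p(1)[of 0] by (simp add: P_def)
    \<comment> \<open>A position of \<open>s\<close> above all p n would contain every iterate,
      hence every pair, and be total too early.\<close>
    have cover: "x \<in> underS s i0 \<or> (\<exists>n. x = p n)" if x: "x \<in> Field s" for x
    proof (rule ccontr)
      assume *: "\<not> ?thesis"
      then have "(i0, x) \<in> s" using Well_order_total[OF s i0(2) x] by blast
      have px: "(p n, x) \<in> s" for n
      proof (induction n)
        case 0
        show ?case using \<open>(i0, x) \<in> s\<close> p0 by simp
      next
        case (Suc n)
        have "(p n, x) \<in> s - Id" using Suc * by auto
        then show ?case using p(2)[of n] by (simp add: succ_pos_def)
      qed
      have "(u, v) \<in> ?L (Inl x)" if uv: "u \<in> V" "v \<in> V" for u v
      proof -
        obtain n where "(u, v) \<in> (cop_step V E ^^ n) (?L i)" using 3(3)[OF uv] by blast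
        then have "(u, v) \<in> ?L (Inl (p n))" using p(1)[of n] by (simp add: P_def)
        moreover have "(Inl (p n), Inl x) \<in> ?r" using px by (simp add: plus_two_eq_osum)
        ultimately show ?thesis using crle_mono[OF r] by blast
      qed
      then have "?L (Inl x) = V \<times> V" using crle_subset[OF r, of V E "Inl x"] by blast
      then show False using nontotal[OF x] by blast
    qed
    let ?a = "Restr s (underS s i0)"
    have "(s, plus_omega ?a) \<in> ordIso" by (rule ordIso_plus_omega[OF s i0(2) p0 p(2) cover])
    moreover have "nonzero_limit ?a"
    proof -
      have "Field ?a = underS s i0"
      proof (rule Refl_Field_Restr2)
        show "Refl s" using s by (simp add: order_on_defs)
        show "underS s i0 \<subseteq> Field s" by (auto simp: underS_def Field_def)
      qed
      moreover have "underS s i0 \<noteq> {}" "\<forall>x\<in>underS s i0. \<exists>y\<in>underS s i0. x \<in> underS s y"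
        using 3(1) by (auto simp: limit_pos_def i0(1))
      ultimately show ?thesis unfolding nonzero_limit_def by (fastforce simp: underS_def)
    qed
    ultimately show ?thesis using Well_order_Restr[OF s] unfolding in_Lambda_def by blast
  qed
qed

section \<open>Trees of lists\<close>

text \<open>A list is a vertex together with its path to the root \<open>[]\<close>: the tail is the
  parent, a new head leads to a child.\<close>

definition list_edge :: "'b list set \<Rightarrow> 'b list \<Rightarrow> 'b list \<Rightarrow> bool" where
  "list_edge V xs ys \<longleftrightarrow> xs \<in> V \<and> ys \<in> V \<and> ((\<exists>x. ys = x # xs) \<or> (\<exists>x. xs = x # ys))"

lemma list_edge_sym: "list_edge V xs ys \<Longrightarrow> list_edge V ys xs"
  by (auto simp: list_edge_def)

lemma list_edge_longer: "list_edge V xs ys \<Longrightarrow> length ys \<le> length xs \<Longrightarrow> ys = tl xs"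
  by (auto simp: list_edge_def)

locale list_tree =
  fixes V :: "'b list set"
  assumes Nil: "[] \<in> V" and tail: "\<And>x xs. x # xs \<in> V \<Longrightarrow> xs \<in> V"
begin

lemma suffix_in: "ys @ xs \<in> V \<Longrightarrow> xs \<in> V"
  by (induction ys) (auto dest: tail)

lemma tree_list: "tree V (list_edge V)"
proof -
  have "simple_graph V (list_edge V)" by (auto simp: simple_graph_def list_edge_def)
  moreover have "connected_graph V (list_edge V)"
  proof -
    let ?R = "{(x, y). list_edge V x y}"
    have "xs \<in> V \<Longrightarrow> (xs, []) \<in> ?R\<^sup>*" for xs
    proof (induction xs)
      case (Cons x xs)
      then have "list_edge V (x # xs) xs" using tail by (auto simp: list_edge_def)
      then show ?case using Cons tail by (blast intro: converse_rtrancl_into_rtrancl)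
    qed simp
    moreover have "sym (?R\<^sup>*)" by (rule sym_rtrancl) (auto simp: sym_def list_edge_sym)
    ultimately show ?thesis
      unfolding connected_graph_def by (meson rtrancl_trans symD)
  qed
  moreover have "\<not> has_cycle V (list_edge V)"
  proof
    assume "has_cycle V (list_edge V)"
    then obtain xs where xs: "3 \<le> length xs" "distinct xs"
      "\<And>i. Suc i < length xs \<Longrightarrow> list_edge V (xs ! i) (xs ! Suc i)" "list_edge V (last xs) (hd xs)"
      unfolding has_cycle_def by blast
    have "xs \<noteq> []" using xs(1) by auto
    \<comment> \<open>A longest list on a cycle can only have its tail as neighbour there, but it
      has two distinct neighbours on the cycle.\<close>
    have "Max (length ` set xs) \<in> length ` set xs" using \<open>xs \<noteq> []\<close> by (intro Max_in) auto
    then obtain i where i: "i < length xs" "length (xs ! i) = Max (length ` set xs)"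
      by (auto simp: in_set_conv_nth)
    have max: "length (xs ! j) \<le> length (xs ! i)" if "j < length xs" for j
      using that unfolding i(2) by (intro Max_ge) auto
    define j where "j = (if Suc i = length xs then 0 else Suc i)"
    define k where "k = (if i = 0 then length xs - 1 else i - 1)"
    have jk: "j < length xs" "k < length xs" "j \<noteq> k" using i(1) xs(1) by (auto simp: j_def k_def)
    have wrap: "list_edge V (xs ! (length xs - 1)) (xs ! 0)"
      using xs(4) \<open>xs \<noteq> []\<close> by (simp add: last_conv_nth hd_conv_nth)
    have "list_edge V (xs ! i) (xs ! j)"
    proof (cases "Suc i = length xs")
      case True
      then show ?thesis using wrap by (simp add: j_def flip: True)
    next
      case False
      then show ?thesis using xs(3)[of i] i(1) by (simp add: j_def)
    qed
    then have "xs ! j = tl (xs ! i)" using list_edge_longer max[OF jk(1)] by blast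
    moreover have "list_edge V (xs ! k) (xs ! i)"
    proof (cases "i = 0")
      case True
      then show ?thesis using wrap by (simp add: k_def)
    next
      case False
      then show ?thesis using xs(3)[of "i - 1"] i(1) by (simp add: k_def)
    qed
    then have "xs ! k = tl (xs ! i)" using list_edge_longer list_edge_sym max[OF jk(2)] by blast
    ultimately show False using nth_eq_iff_index_eq[OF xs(2) jk(1,2)] jk(3) by simp
  qed
  ultimately show ?thesis using Nil by (auto simp: tree_def)
qed

lemma cnbhd_list_iff: "xs \<in> cnbhd V (list_edge V) ys \<longleftrightarrow> xs = ys \<or> list_edge V ys xs"
  by (auto simp: cnbhd_def list_edge_def)

text \<open>From the root the cop always moves to the suffix of the robber's list that is one entry
  longer than its own. As long as the robber escapes, the cop itself traces a ray.\<close>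

lemma cop_win_list:
  assumes no_ray: "\<And>f. (\<And>n. f n \<in> V) \<Longrightarrow> \<exists>n. \<forall>x. f (Suc n) \<noteq> x # f n"
  shows "cop_win V (list_edge V)"
proof -
  \<comment> \<open>The last entry of the history is the robber's position and the one before it the
    cop's. If they coincide, the truncated difference is 0 and the cop stays.\<close>
  define \<sigma> :: "'b list list \<Rightarrow> 'b list" where
    "\<sigma> h = (if h = [] then []
            else drop (length (last h) - Suc (length (last (butlast h)))) (last h))" for h
  have history: "\<sigma> (history c r n) = drop (length (r n) - Suc (length (c n))) (r n)" for c r n
    by (simp add: \<sigma>_def history_def butlast_append)
  have "\<exists>n. (\<forall>m\<le>n. c (Suc m) \<in> cnbhd V (list_edge V) (c m)) \<and> (c n = r n \<or> c (Suc n) = r n)"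
    if c0: "c 0 = \<sigma> []" and c: "\<And>n. c (Suc n) = \<sigma> (history c r n)"
      and r0: "r 0 \<in> V" and r: "\<And>n. r (Suc n) \<in> cnbhd V (list_edge V) (r n)" for c r
  proof (rule ccontr)
    assume "\<not> ?thesis"
    then have free: "\<not> (c n = r n \<or> c (Suc n) = r n)"
      if "\<forall>m\<le>n. c (Suc m) \<in> cnbhd V (list_edge V) (c m)" for n
      using that by blast
    have inv: "(\<forall>m<n. c (Suc m) \<in> cnbhd V (list_edge V) (c m) \<and> (\<exists>x. c (Suc m) = x # c m)) \<and>
        r n \<in> V \<and> (\<exists>ys. r n = ys @ c n)" for n
    proof (induction n)
      case 0
      then show ?case using r0 c0 by (simp add: \<sigma>_def)
    next
      case (Suc n)
      then obtain ys where ys: "r n = ys @ c n" by blast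
      have legal: "\<forall>m<n. c (Suc m) \<in> cnbhd V (list_edge V) (c m)" using Suc by blast
      have cn: "c n \<in> V" using Suc ys suffix_in by metis
      have "ys \<noteq> []"
      proof
        assume "ys = []"
        then have "c n = r n" "c (Suc n) = c n" using ys c[of n] history by simp_all
        then show False using free[of n] legal by (metis cnbhd_list_iff le_neq_implies_less)
      qed
      then obtain zs x where zs: "ys = zs @ [x]" by (metis rev_exhaust)
      have cS: "c (Suc n) = x # c n" using c[of n] history[of c r n] ys zs by simp
      have "x # c n \<in> V" using Suc ys zs suffix_in[of zs "x # c n"] by simp
      then have ln: "c (Suc n) \<in> cnbhd V (list_edge V) (c n)"
        using cn cS by (auto simp: cnbhd_list_iff list_edge_def)
      then have legal': "\<forall>m\<le>n. c (Suc m) \<in> cnbhd V (list_edge V) (c m)"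
        using legal by (metis le_neq_implies_less)
      \<comment> \<open>The robber is strictly above the cop's new position, so even a step to the
        parent keeps that position a suffix.\<close>
      have "zs \<noteq> []" using free[OF legal'] ys zs cS by auto
      have "r (Suc n) \<in> V \<and> (\<exists>ys. r (Suc n) = ys @ c (Suc n))"
      proof -
        have rn: "r n = zs @ c (Suc n)" using ys zs cS by simp
        consider "r (Suc n) = r n" | y where "r (Suc n) = y # r n" "r (Suc n) \<in> V"
          | y where "r n = y # r (Suc n)" "r (Suc n) \<in> V"
          using r[of n] by (auto simp: cnbhd_list_iff list_edge_def)
        then show ?thesis
        proof cases
          case 1
          then show ?thesis using rn Suc by auto
        next
          case (2 y)
          then show ?thesis using rn by (metis append_Cons)
        next
          case (3 y)
          then show ?thesis using rn \<open>zs \<noteq> []\<close> by (metis append_eq_Cons_conv)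
        qed
      qed
      moreover have "\<forall>m<Suc n. c (Suc m) \<in> cnbhd V (list_edge V) (c m) \<and> (\<exists>x. c (Suc m) = x # c m)"
        using Suc ln cS by (auto simp: less_Suc_eq)
      ultimately show ?case by blast
    qed
    have "c n \<in> V" for n using inv[of n] suffix_in by metis
    then obtain n where "\<forall>x. c (Suc n) \<noteq> x # c n" using no_ray by blast
    then show False using inv[of "Suc n"] by blast
  qed
  moreover have "\<sigma> [] \<in> V" using Nil by (simp add: \<sigma>_def)
  ultimately show ?thesis unfolding cop_win_def by blast
qed

end

section \<open>Realisation of all ordinals\<close>

lemma Id_on_subset_cop_step_funpow: "Id_on V \<subseteq> (cop_step V E ^^ n) (Id_on V)"
  by (induction n) (auto dest: Id_on_subset_cop_step)

text \<open>A path with \<open>card (Field s)\<close> edges. Its vertices are constant lists, told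
  apart by length, so that \<open>list_tree\<close> applies.\<close>

lemma finite_ordinal_realised:
  fixes s :: "'b rel"
  assumes s: "Well_order s" and fin: "finite (Field s)"
  shows "\<exists>(V :: 'b list set) E. tree V E \<and> cop_win V E \<and> is_CR_ordinal V E s"
proof -
  define N where "N = card (Field s)"
  define p :: "nat \<Rightarrow> 'b list" where "p k = replicate k undefined" for k
  define V where "V = p ` {..N}"
  have p_inj: "p j = p k \<longleftrightarrow> j = k" for j k by (simp add: p_def)
  have pV: "p k \<in> V \<longleftrightarrow> k \<le> N" for k by (auto simp: V_def p_inj)
  have p_Cons: "p j = x # p k \<longleftrightarrow> x = undefined \<and> j = Suc k" for x j k
    by (cases j) (auto simp: p_def replicate_eq_replicate)
  interpret list_tree V
  proof
    show "[] \<in> V" by (auto simp: V_def p_def)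
    fix x xs assume "x # xs \<in> V"
    then obtain k where "k \<le> N" "x # xs = p k" by (auto simp: V_def)
    then show "xs \<in> V" by (cases k) (auto simp: V_def p_def)
  qed
  let ?E = "list_edge V"
  have cn: "z \<in> cnbhd V ?E (p k) \<longleftrightarrow> (\<exists>j\<le>N. z = p j \<and> (j = k \<or> j = Suc k \<or> k = Suc j))"
    if "k \<le> N" for z k
    using that unfolding cnbhd_list_iff list_edge_def
    by (auto simp: pV p_Cons V_def p_inj)
  \<comment> \<open>A cop at b walking towards the robber needs at most its distance to the end
    behind the robber: N - b if that end is N, and b if it is 0.\<close>
  have upper: "(p a, p b) \<in> (cop_step V ?E ^^ m) (Id_on V)"
    if "a \<le> N" "b \<le> N" "b \<le> a \<and> N - b \<le> m \<or> a \<le> b \<and> b \<le> m" for a b m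
    using that
  proof (induction m arbitrary: a b)
    case 0
    then show ?case by (auto simp: pV)
  next
    case (Suc m)
    have diag: "(p j, p j) \<in> (cop_step V ?E ^^ m) (Id_on V)" if "j \<le> N" for j
      using Id_on_subset_cop_step_funpow[where V = V and E = ?E and n = m] that pV by auto
    have "\<exists>y\<in>cnbhd V ?E (p b). (x, y) \<in> (cop_step V ?E ^^ m) (Id_on V)"
      if x: "x \<in> cnbhd V ?E (p a)" for x
    proof -
      obtain j where j: "j \<le> N" "x = p j" "j = a \<or> j = Suc a \<or> a = Suc j"
        using iffD1[OF cn[OF Suc.prems(1)] x] by blast
      consider "a = b \<or> j = b" | "b < a" "b < j" | "a < b" "j < b" using j(3) by linarith
      then show ?thesis
      proof cases
        case 1
        then have "p j \<in> cnbhd V ?E (p b)" using j cn[OF Suc.prems(2), of "p j"] by blast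
        then show ?thesis using diag[OF j(1)] j(2) by blast
      next
        case 2
        have "p (Suc b) \<in> cnbhd V ?E (p b)" using 2 j(1) cn[OF Suc.prems(2)] by (simp add: p_inj)
        moreover have "(p j, p (Suc b)) \<in> (cop_step V ?E ^^ m) (Id_on V)"
          by (rule Suc.IH) (use 2 j(1) Suc.prems in auto)
        ultimately show ?thesis using j(2) by blast
      next
        case 3
        have "p (b - 1) \<in> cnbhd V ?E (p b)" using 3 Suc.prems(2) cn[OF Suc.prems(2)] by (simp add: p_inj)
        moreover have "(p j, p (b - 1)) \<in> (cop_step V ?E ^^ m) (Id_on V)"
          by (rule Suc.IH) (use 3 j(1) Suc.prems in auto)
        ultimately show ?thesis using j(2) by blast
      qed
    qed
    then show ?case using Suc.prems pV by (simp add: cop_step_iff)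
  qed
  \<comment> \<open>The robber stands still, and the cop gains at most one edge per round.\<close>
  have lower: "a \<le> b + m" if "(p a, p b) \<in> (cop_step V ?E ^^ m) (Id_on V)" "a \<le> N" "b \<le> N" for a b m
    using that
  proof (induction m arbitrary: b)
    case 0
    then show ?case by (auto simp: p_inj)
  next
    case (Suc m)
    then obtain y where y: "y \<in> cnbhd V ?E (p b)" "(p a, y) \<in> (cop_step V ?E ^^ m) (Id_on V)"
      using self_in_cnbhd[of "p a" V ?E] by (auto simp: cop_step_iff)
    then obtain j where "j \<le> N" "y = p j" "j \<le> Suc b" using cn[OF Suc.prems(3)] by auto
    then show ?case using Suc.IH[of j] y(2) Suc.prems(2) by simp
  qed
  have r: "Well_order (plus_two s)" by (rule Well_order_plus_two[OF s])
  have "is_CR_ordinal V ?E s"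
  proof (rule is_CR_ordinalI[OF s])
    have "crle V ?E (plus_two s) (Inr False) = (cop_step V ?E ^^ N) (Id_on V)"
      using crle_finite_pos[OF r, of "Inr False" V ?E] fin by (simp add: card_image N_def)
    moreover have "V \<times> V \<subseteq> (cop_step V ?E ^^ N) (Id_on V)"
    proof (rule subrelI)
      fix x y assume "(x, y) \<in> V \<times> V"
      then obtain a b where "a \<le> N" "b \<le> N" "x = p a" "y = p b" by (auto simp: V_def)
      then show "(x, y) \<in> (cop_step V ?E ^^ N) (Id_on V)" using upper[of a b N] nat_le_linear[of b a] by simp
    qed
    ultimately show "crle V ?E (plus_two s) (Inr False) = V \<times> V"
      using crle_subset[OF r, of V ?E "Inr False"] by blast
  next
    fix j assume j: "j \<in> Field s"
    have sub: "underS s j \<subset> Field s" using j by (auto simp: underS_def Field_def)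
    then have fin': "finite (underS s j)" and card: "card (underS s j) < N"
      using fin psubset_card_mono[OF fin sub] by (auto simp: N_def intro: finite_subset)
    have "crle V ?E (plus_two s) (Inl j) = (cop_step V ?E ^^ card (underS s j)) (Id_on V)"
      using crle_finite_pos[OF r, of "Inl j" V ?E] fin' by (simp add: card_image)
    then have "(p N, p 0) \<notin> crle V ?E (plus_two s) (Inl j)"
      using lower[of N 0 "card (underS s j)"] card by auto
    then show "crle V ?E (plus_two s) (Inl j) \<noteq> V \<times> V" using pV by auto
  qed
  moreover have "cop_win V ?E"
  proof (rule cop_win_list, rule ccontr)
    fix f :: "nat \<Rightarrow> 'b list"
    assume f: "\<And>n. f n \<in> V" and "\<not> (\<exists>n. \<forall>x. f (Suc n) \<noteq> x # f n)"
    then have "\<forall>n. \<exists>x. f (Suc n) = x # f n" by blast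
    then have "length (f (Suc n)) = Suc (length (f n))" for n by (metis length_Cons)
    then have "n \<le> length (f n)" for n by (induction n) auto
    moreover have "length (f (Suc N)) \<le> N" using f[of "Suc N"] by (auto simp: V_def p_def)
    ultimately show False by (metis not_less_eq_eq)
  qed
  ultimately show ?thesis using tree_list by (intro exI[of _ V] exI[of _ ?E] conjI)
qed

lemma infinite_ordinal_realised:
  fixes s a :: "'b rel"
  assumes s: "Well_order s" and a: "Well_order a" "nonzero_limit a"
    and iso: "(s, plus_omega a) \<in> ordIso"
  shows "\<exists>(V :: 'b list set) E. tree V E \<and> cop_win V E \<and> is_CR_ordinal V E s"
proof -
  \<comment> \<open>Read from the end, these are the finite descending sequences: each new head is
    smaller than the previous one.\<close>
  define V where "V = {xs. set xs \<subseteq> Field a \<and> sorted_wrt (\<lambda>x y. x \<in> underS a y) xs}"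
  interpret list_tree V by standard (auto simp: V_def)
  let ?E = "list_edge V" and ?q = "plus_omega a" and ?r = "plus_two s"
  interpret tree_graph V ?E by standard (rule tree_list)
  note q = Well_order_plus_omega[OF a(1)] and r = Well_order_plus_two[OF s]
  have Cons2: "y # x # xs \<in> V \<longleftrightarrow> x # xs \<in> V \<and> y \<in> underS a x" for x y xs
  proof
    show "x # xs \<in> V \<and> y \<in> underS a x" if "y # x # xs \<in> V" using that by (simp add: V_def)
    show "y # x # xs \<in> V" if xs: "x # xs \<in> V \<and> y \<in> underS a x"
    proof -
      have "y \<in> underS a z" if "z \<in> set xs" for z
      proof (rule underS_trans[OF a(1)])
        show "y \<in> underS a x" using xs by simp
        show "(x, z) \<in> a" using xs that by (simp add: V_def underS_def)
      qed
      moreover have "y \<in> Field a" using xs by (auto simp: underS_def Field_def)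
      ultimately show ?thesis using xs by (simp add: V_def)
    qed
  qed
  have singleton: "[x] \<in> V \<longleftrightarrow> x \<in> Field a" for x by (simp add: V_def)
  have hd_Field: "x \<in> Field a" if "x # xs \<in> V" for x xs using that by (simp add: V_def)
  \<comment> \<open>Together with \<open>rank_ge\<close>: the arc from a list to its parent has rank
    exactly its head, whatever the tail, since the children have as heads precisely the smaller
    elements.\<close>
  have rank_le: "(x # xs, xs) \<in> arc_rank ?E ?q (Inl x)" if "x # xs \<in> V" for x xs
    using a(1) that
  proof (induction x arbitrary: xs rule: underS_induct)
    case (less x)
    have E: "?E (x # xs) xs" using less.prems tail by (auto simp: list_edge_def)
    have "(z, x # xs) \<in> (\<Union>j\<in>underS ?q (Inl x). arc_rank ?E ?q j)"
      if z: "?E z (x # xs)" "z \<noteq> xs" for z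
    proof -
      obtain y where y: "z = y # x # xs" "z \<in> V" using z by (auto simp: list_edge_def)
      then have "y \<in> underS a x" using Cons2 by blast
      then show ?thesis using less.IH[of y "x # xs"] y by auto
    qed
    then show ?case unfolding arc_rank_rec[OF q, of ?E "Inl x"] arc_step_iff using E by blast
  qed
  have rank_ge: "(x, y) \<in> a"
    if "(x # xs, xs) \<in> arc_rank ?E ?q (Inl y)" "x # xs \<in> V" "y \<in> Field a" for x y xs
    using a(1) that
  proof (induction y arbitrary: x xs rule: underS_induct)
    case (less y)
    show ?case
    proof (rule ccontr)
      assume "(x, y) \<notin> a"
      then have y: "y \<in> underS a x"
        using Well_order_total[OF a(1) hd_Field[OF less.prems(2)] less.prems(3)] by blast
      then have "?E (y # x # xs) (x # xs)" using Cons2 less.prems(2) by (auto simp: list_edge_def)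
      moreover have "y # x # xs \<noteq> xs" by (rule notI, drule arg_cong[of _ _ length]) simp
      ultimately obtain z where z: "z \<in> underS a y" "(y # x # xs, x # xs) \<in> arc_rank ?E ?q (Inl z)"
        using less.prems(1) unfolding arc_rank_rec[OF q, of ?E "Inl y"] arc_step_iff by auto
      have "z \<in> Field a" using z(1) by (auto simp: underS_def Field_def)
      then have "(y, z) \<in> a" using less.IH[OF z] Cons2 y less.prems(2) by blast
      then show False using z(1) Well_order_antisym[OF a(1)] by (auto simp: underS_def)
    qed
  qed
  have root_E: "?E x [] \<longleftrightarrow> (\<exists>y\<in>Field a. x = [y])" for x
    using Nil singleton by (auto simp: list_edge_def)
  have lim: "limit_pos ?q (Inr 0)"
    using a(2) by (auto simp: limit_pos_def nonzero_limit_def underS_def[of a])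
  have nontotal: "(cop_step V ?E ^^ n) (crle V ?E ?q (Inr 0)) \<noteq> V \<times> V" for n
  proof (rule limit_vertex_lower_bound[OF q lim Nil, where C = "{x. ?E x []}"])
    show "?E x []" if "x \<in> {x. ?E x []}" for x using that by simp
    show "\<exists>j\<in>underS ?q (Inr 0). (x, []) \<in> arc_rank ?E ?q j" if "x \<in> {x. ?E x []}" for x
      using that rank_le[of _ "[]"] singleton root_E by auto
    show "\<exists>x\<in>{x. ?E x []}. (x, []) \<notin> arc_rank ?E ?q j" if j: "j \<in> underS ?q (Inr 0)" for j
    proof -
      obtain y where y: "j = Inl y" "y \<in> Field a" using j by auto
      then obtain x where x: "x \<in> Field a" "(y, x) \<in> a" "y \<noteq> x"
        using a(2) by (auto simp: nonzero_limit_def)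
      then have "([x], []) \<notin> arc_rank ?E ?q j"
        using rank_ge[of x "[]" y] y singleton Well_order_antisym[OF a(1), of x y] by blast
      then show ?thesis using root_E x(1) by blast
    qed
  qed
  have rooted: "arcs_into ?E (arc_rank ?E ?q (Inr 0)) []"
    unfolding arcs_into_def
  proof (intro allI impI)
    fix x assume "?E x []"
    then obtain y where y: "y \<in> Field a" "x = [y]" using root_E by blast
    then have "(Inl y, Inr 0) \<in> ?q" by (auto simp: plus_omega_def)
    then show "(x, []) \<in> arc_rank ?E ?q (Inr 0)"
      using arc_rank_mono[OF q] rank_le[of y "[]"] singleton y by blast
  qed
  have succ: "succ_pos ?q (Inr n) (Inr (Suc n))" for n
    unfolding succ_pos_def by (auto simp: plus_omega_def)
  have crle_n: "crle V ?E ?q (Inr n) = (cop_step V ?E ^^ n) (crle V ?E ?q (Inr 0))" for n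
    by (induction n) (simp_all add: crle_succ_pos[OF q succ])
  \<comment> \<open>All arcs into the root have rank below \<alpha>; re-rooting from there bounds
    every other arc, including those pointing away from the root, with a finite excess.\<close>
  have reach: "\<exists>n. (u, v) \<in> crle V ?E ?q (Inr n)" if "u \<in> V" "v \<in> V" for u v
  proof (rule limit_vertex_upper_bound[OF q _ that, of "Inr 0"])
    fix x y assume xy: "?E x y"
    obtain n where "arcs_into ?E ((arc_step ?E ^^ n) (arc_rank ?E ?q (Inr 0))) y"
      using arcs_into_reroot[OF arc_rank_closed[OF q] rooted Nil edgeD(2)[OF xy]] .
    then show "\<exists>n. (x, y) \<in> (arc_step ?E ^^ n) (arc_rank ?E ?q (Inr 0))"
      using xy by (auto simp: arcs_into_def)
  next
    fix n assume "(u, v) \<in> (cop_step V ?E ^^ n) (crle V ?E ?q (Inr 0))"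
    then show "\<exists>n. (u, v) \<in> crle V ?E ?q (Inr n)" unfolding crle_n[of n, symmetric] by (rule exI)
  qed
  obtain f where f: "embed ?q s f" "bij_betw f (Field ?q) (Field s)"
    using ordIso_symmetric[OF iso] by (auto simp: ordIso_def iso_def)
  let ?g = "\<lambda>i. Inl (f i)"
  \<comment> \<open>Everything so far was computed in \<open>plus_omega a\<close>; the isomorphism
    onto \<open>s\<close> carries it over.\<close>
  have g: "crle V ?E ?r (?g i) = crle V ?E ?q i" if "i \<in> Field ?q" for i
  proof (rule crle_initial_segment[OF q r _ that])
    fix i assume "i \<in> Field ?q"
    then have "underS s (f i) = f ` underS ?q i"
      using embed_underS[OF q f(1)] by (simp add: bij_betw_def)
    then show "underS ?r (?g i) = ?g ` underS ?q i" by (simp add: image_image)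
  qed
  have "is_CR_ordinal V ?E s"
  proof (rule is_CR_ordinalI[OF s])
    have "(u, v) \<in> crle V ?E ?r (Inr False)" if uv: "u \<in> V" "v \<in> V" for u v
    proof -
      obtain n where n: "(u, v) \<in> crle V ?E ?q (Inr n)" using reach[OF uv] by blast
      have F: "Inr n \<in> Field ?q" by (simp add: Field_plus_omega)
      then have "f (Inr n) \<in> Field s" using f(2) by (auto simp: bij_betw_def)
      then have "(?g (Inr n), Inr False) \<in> ?r" by (auto simp: plus_two_def)
      then show ?thesis using n g[OF F] crle_mono[OF r] by blast
    qed
    then show "crle V ?E ?r (Inr False) = V \<times> V"
      using crle_subset[OF r, of V ?E "Inr False"] by blast
  next
    fix j assume "j \<in> Field s"
    then obtain i where i: "i \<in> Field ?q" "j = f i" using f(2) by (auto simp: bij_betw_def)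
    have "crle V ?E ?q i \<noteq> V \<times> V"
    proof (cases i)
      case (Inl x)
      then have "(i, Inr 0) \<in> ?q" using i(1) unfolding Field_plus_omega by (auto simp: plus_omega_def)
      then show ?thesis
        using crle_mono[OF q] crle_subset[OF q, of V ?E "Inr 0"] nontotal[of 0] by fastforce
    next
      case (Inr n)
      then show ?thesis using nontotal[of n] crle_n[of n] by simp
    qed
    then show "crle V ?E ?r (Inl j) \<noteq> V \<times> V" using g[OF i(1)] i(2) by simp
  qed
  moreover have "cop_win V ?E"
  proof (rule cop_win_list, rule ccontr)
    fix h :: "nat \<Rightarrow> 'b list"
    assume h: "\<And>n. h n \<in> V" and "\<not> (\<exists>n. \<forall>x. h (Suc n) \<noteq> x # h n)"
    then have "\<forall>n. \<exists>x. h (Suc n) = x # h n" by blast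
    then obtain x where x: "\<And>n. h (Suc n) = x n # h n" by metis
    have "(x (Suc n), x n) \<in> a - Id" for n
      using h[of "Suc (Suc n)"] x[of "Suc n"] x[of n] Cons2 by (auto simp: underS_def)
    then show False using Well_order_wf[OF a(1)] by (auto simp: wf_iff_no_infinite_down_chain)
  qed
  ultimately show ?thesis using tree_list by (intro exI[of _ V] exI[of _ ?E] conjI)
qed

theorem theorem3p1:
  shows "(\<forall>(V :: 'a set) E (s :: 'b rel).
            tree V E \<and> cop_win V E \<and> is_CR_ordinal V E s \<longrightarrow> in_Lambda s) \<and>
         (\<forall>s :: 'b rel. Well_order s \<and> in_Lambda s \<longrightarrow>
            (\<exists>(V :: 'b list set) E. tree V E \<and> cop_win V E \<and> is_CR_ordinal V E s))"
proof (intro conjI allI impI; elim conjE)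
  show "in_Lambda s" if "tree V E" "cop_win V E" "is_CR_ordinal V E s"
    for V :: "'a set" and E and s :: "'b rel"
    using that by (rule CR_ordinal_in_Lambda)
  show "\<exists>(V :: 'b list set) E. tree V E \<and> cop_win V E \<and> is_CR_ordinal V E s"
    if "Well_order s" "in_Lambda s" for s :: "'b rel"
    using that finite_ordinal_realised infinite_ordinal_realised unfolding in_Lambda_def by blast
qed

end
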